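(* Suppose that $\mu_x$ is not a point mass. Then: 1. $\mathcal D$ and $\mathcal M$ are open subsets of $\mathbb C$. 2. $\delta_0$ and $h$ are differentiable on $\mathcal D$ (as functions of two real variables). 3. $h$ is injective on $\mathcal D$ (hence a bijection from $\mathcal D$ onto $\mathcal M$). 4. The function $h^{-1}:\mathcal M\to\mathcal D$ is differentiable on $\mathcal M$ (as a function of two real variables).
   Context: $(\mathcal A,\varphi)$ is a $W^*$-probability space where $\varphi$ is a faithful trace. $x,y\in\mathcal A$ are selfadjoint and freely independent, and $y$ has free Poisson distribution with parameter $p\in(0,\infty)$ (all free cumulants of $y$ equal $p$). $\mu_x$ is the distribution of $x$ with respect to $\varphi$. Let $E:M_2(\mathcal A)\to M_2(\mathbb C)$ apply $\varphi$ entrywise, $X=\begin{bmatrix}0 & x \\ x & 0\end{bmatrix}$, $J=\begin{bmatrix}0&\mathrm i\\-\mathrm i&0\end{bmatrix}$, and $\mathbb H_2^+=\{B\in M_2(\mathbb C):\Im B=\frac1{2\mathrm i}(B-B^* )\text{ is positive definite and invertible}\}$. Put $G_X(B)=E((B-X)^{-1})$ and $H(B)=B+p\,(J-G_X(B))^{-1}$ for $B\in\mathbb H_2^+$. For $\lambda\in\mathbb C$, $\zeta\in\mathbb C^+$ let $B(\lambda,\zeta)=\begin{bmatrix}\zeta&\lambda\\ \bar\lambda&\zeta\end{bmatrix}$, and let $H_{ij}(\lambda,\zeta)$ be the $(i,j)$-entry of $H(B(\lambda,\zeta))$. For every $\lambda$, $\Re H_{11}(\lambda,\mathrm i\delta)=0$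 for $\delta>0$ and the map $\delta\mapsto\Im H_{11}(\lambda,\mathrm i\delta)/\delta$ is continuous and strictly increasing on $(0,\infty)$ with limit $1$ at $\infty$. Set $\mathcal D=\{\lambda\in\mathbb C:\lim_{\delta\to0^+}\Im H_{11}(\lambda,\mathrm i\delta)/\delta<0\}$. For $\lambda\in\mathcal D$ let $\delta_0(\lambda)\in(0,\infty)$ be the unique number with $H_{11}(\lambda,\mathrm i\delta_0(\lambda))=0$, and put $h(\lambda)=H_{12}(\lambda,\mathrm i\delta_0(\lambda))$ and $\mathcal M=h(\mathcal D)$. *)

theory Defs
  imports "HOL-Probability.Probability"
begin

section \<open>Abstract W*-probability spaces\<close>

class cstar_algebra = real_normed_algebra_1 + banach +
  fixes scaleC :: "complex \<Rightarrow> 'a \<Rightarrow> 'a" (infixr \<open>*\<^sub>C\<close> 75)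
    and star :: "'a \<Rightarrow> 'a"
  assumes scaleC_add_right: "c *\<^sub>C (a + b) = c *\<^sub>C a + c *\<^sub>C b"
    and scaleC_add_left: "(c + d) *\<^sub>C a = c *\<^sub>C a + d *\<^sub>C a"
    and scaleC_scaleC: "c *\<^sub>C (d *\<^sub>C a) = (c * d) *\<^sub>C a"
    and scaleC_of_real: "complex_of_real r *\<^sub>C a = r *\<^sub>R a"
    and mult_scaleC_left: "(c *\<^sub>C a) * b = c *\<^sub>C (a * b)"
    and mult_scaleC_right: "a * (c *\<^sub>C b) = c *\<^sub>C (a * b)"
    and norm_scaleC: "norm (c *\<^sub>C a) = cmod c * norm a"
    and star_star: "star (star a) = a"
    and star_add: "star (a + b) = star a + star b"
    and star_mult: "star (a * b) = star b * star a"
    and star_scaleC: "star (c *\<^sub>C a) = cnj c *\<^sub>C star a"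
    and cstar_identity: "norm (star a * a) = (norm a)\<^sup>2"

definition selfadjoint :: "'a::cstar_algebra \<Rightarrow> bool" where
  "selfadjoint a \<longleftrightarrow> star a = a"

definition clinear_functional :: "('a::cstar_algebra \<Rightarrow> complex) \<Rightarrow> bool" where
  "clinear_functional f \<longleftrightarrow>
     (\<forall>a b. f (a + b) = f a + f b) \<and> (\<forall>c a. f (c *\<^sub>C a) = c * f a)"

text \<open>
  Sakai's definition: a W*-algebra is a C*-algebra that is the dual of a Banach space.  The predual
  is represented by a norm-closed complex subspace \<open>P\<close> of the dual of the algebra such that
  evaluation is an isometric isomorphism from the algebra onto the dual of \<open>P\<close>.
  The predual is unique as a set of functionals, and its elements are the normal functionals.
\<close>

definition is_predual :: "('a::cstar_algebra \<Rightarrow>\<^sub>L complex) set \<Rightarrow> bool" where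
  "is_predual P \<longleftrightarrow>
     (\<forall>f\<in>P. clinear_functional (blinfun_apply f)) \<and>
     closed P \<and> 0 \<in> P \<and> (\<forall>f\<in>P. \<forall>g\<in>P. f + g \<in> P) \<and>
     (\<forall>f\<in>P. \<forall>c. blinfun_compose (blinfun_mult_right c) f \<in> P) \<and>
     (\<forall>a. norm a = (SUP f\<in>{f\<in>P. norm f \<le> 1}. cmod (blinfun_apply f a))) \<and>
     (\<forall>F. (\<forall>f\<in>P. \<forall>g\<in>P. F (f + g) = F f + F g) \<and>
          (\<forall>f\<in>P. \<forall>c. F (blinfun_compose (blinfun_mult_right c) f) = c * F f) \<and>
          (\<exists>K. \<forall>f\<in>P. cmod (F f) \<le> K * norm f)
        \<longrightarrow> (\<exists>a. \<forall>f\<in>P. F f = blinfun_apply f a))"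

definition state :: "('a::cstar_algebra \<Rightarrow> complex) \<Rightarrow> bool" where
  "state \<phi> \<longleftrightarrow> clinear_functional \<phi> \<and> \<phi> 1 = 1 \<and> (\<forall>a. \<phi> (star a * a) \<in> \<real>\<^sub>\<ge>\<^sub>0)"

text \<open>The algebra is the whole type; its W*-structure and the normality of \<open>\<phi>\<close> are both expressed
  through the predual.\<close>

definition wstar_probability_space :: "('a::cstar_algebra \<Rightarrow> complex) \<Rightarrow> bool" where
  "wstar_probability_space \<phi> \<longleftrightarrow>
     state \<phi> \<and> (\<exists>P. is_predual P \<and> (\<exists>f\<in>P. blinfun_apply f = \<phi>))"

definition faithful :: "('a::cstar_algebra \<Rightarrow> complex) \<Rightarrow> bool" where
  "faithful \<phi> \<longleftrightarrow> (\<forall>a. \<phi> (star a * a) = 0 \<longrightarrow> a = 0)"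

definition tracial :: "('a::cstar_algebra \<Rightarrow> complex) \<Rightarrow> bool" where
  "tracial \<phi> \<longleftrightarrow> (\<forall>a b. \<phi> (a * b) = \<phi> (b * a))"

text \<open>The distribution of a selfadjoint element, as the compactly supported probability measure
  on the real line with the moments of that element.\<close>

definition has_distribution ::
    "('a::cstar_algebra \<Rightarrow> complex) \<Rightarrow> 'a \<Rightarrow> real measure \<Rightarrow> bool" where
  "has_distribution \<phi> x \<mu> \<longleftrightarrow>
     prob_space \<mu> \<and> sets \<mu> = sets borel \<and> (\<exists>R. AE t in \<mu>. \<bar>t\<bar> \<le> R) \<and>
     (\<forall>n. \<phi> (x ^ n) = complex_of_real (\<integral>t. t ^ n \<partial>\<mu>))"


section \<open>Freeness and the free Poisson distribution\<close>

inductive_set star_subalgebra :: "'a::cstar_algebra set \<Rightarrow> 'a set" for S where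
  gen: "a \<in> S \<Longrightarrow> a \<in> star_subalgebra S"
| one: "1 \<in> star_subalgebra S"
| add: "\<lbrakk>a \<in> star_subalgebra S; b \<in> star_subalgebra S\<rbrakk> \<Longrightarrow> a + b \<in> star_subalgebra S"
| mult: "\<lbrakk>a \<in> star_subalgebra S; b \<in> star_subalgebra S\<rbrakk> \<Longrightarrow> a * b \<in> star_subalgebra S"
| scaleC: "a \<in> star_subalgebra S \<Longrightarrow> c *\<^sub>C a \<in> star_subalgebra S"
| star: "a \<in> star_subalgebra S \<Longrightarrow> star a \<in> star_subalgebra S"

text \<open>In the alternating products every factor is tagged with the index of its subalgebra.\<close>

definition free_subalgebras ::
    "('a::cstar_algebra \<Rightarrow> complex) \<Rightarrow> ('i \<Rightarrow> 'a set) \<Rightarrow> bool" where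
  "free_subalgebras \<phi> \<A> \<longleftrightarrow>
     (\<forall>ws. ws \<noteq> [] \<and> successively (\<lambda>u v. fst u \<noteq> fst v) ws \<and>
           (\<forall>(i, a)\<in>set ws. a \<in> \<A> i \<and> \<phi> a = 0)
        \<longrightarrow> \<phi> (prod_list (map snd ws)) = 0)"

definition freely_independent :: "('a::cstar_algebra \<Rightarrow> complex) \<Rightarrow> 'a \<Rightarrow> 'a \<Rightarrow> bool" where
  "freely_independent \<phi> x y \<longleftrightarrow>
     free_subalgebras \<phi> (\<lambda>i::bool. star_subalgebra {if i then x else y})"

definition noncrossing_partitions :: "nat \<Rightarrow> nat set set set" where
  "noncrossing_partitions n =
     {\<pi>. partition_on {1..n} \<pi> \<and>
         \<not> (\<exists>V\<in>\<pi>. \<exists>W\<in>\<pi>. V \<noteq> W \<and>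
              (\<exists>a\<in>V. \<exists>b\<in>W. \<exists>c\<in>V. \<exists>d\<in>W. a < b \<and> b < c \<and> c < d))}"

text \<open>The free moment-cumulant formula; it determines \<open>\<kappa> n\<close> for all \<open>n \<ge> 1\<close>, and \<open>\<kappa> 0\<close> is
  irrelevant.\<close>

definition has_free_cumulants ::
    "('a::cstar_algebra \<Rightarrow> complex) \<Rightarrow> 'a \<Rightarrow> (nat \<Rightarrow> complex) \<Rightarrow> bool" where
  "has_free_cumulants \<phi> y \<kappa> \<longleftrightarrow>
     (\<forall>n\<ge>1. \<phi> (y ^ n) = (\<Sum>\<pi>\<in>noncrossing_partitions n. \<Prod>V\<in>\<pi>. \<kappa> (card V)))"

definition free_poisson :: "('a::cstar_algebra \<Rightarrow> complex) \<Rightarrow> 'a \<Rightarrow> real \<Rightarrow> bool" where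
  "free_poisson \<phi> y p \<longleftrightarrow> has_free_cumulants \<phi> y (\<lambda>n. complex_of_real p)"


section \<open>The matrix-valued functions\<close>

text \<open>Inverses are \<^const>\<open>matrix_inv\<close>, the two-sided inverse of a matrix over a
  possibly noncommutative ring; it is unspecified for singular matrices.\<close>

definition matrix_of_scalars :: "complex^2^2 \<Rightarrow> ('a::cstar_algebra)^2^2" where
  "matrix_of_scalars B = (\<chi> i j. (B $ i $ j) *\<^sub>C 1)"

definition entrywise :: "('a \<Rightarrow> complex) \<Rightarrow> 'a^2^2 \<Rightarrow> complex^2^2" where
  "entrywise \<phi> M = (\<chi> i j. \<phi> (M $ i $ j))"

definition hermitization :: "'a::cstar_algebra \<Rightarrow> 'a^2^2" where
  "hermitization x = vector [vector [0, x], vector [x, 0]]"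

definition J_mat :: "complex^2^2" where
  "J_mat = vector [vector [0, \<i>], vector [- \<i>, 0]]"

definition adjoint_matrix :: "complex^2^2 \<Rightarrow> complex^2^2" where
  "adjoint_matrix B = (\<chi> i j. cnj (B $ j $ i))"

definition Im_matrix :: "complex^2^2 \<Rightarrow> complex^2^2" where
  "Im_matrix B = (\<chi> i j. (B $ i $ j - adjoint_matrix B $ i $ j) / (2 * \<i>))"

definition positive_definite :: "complex^2^2 \<Rightarrow> bool" where
  "positive_definite A \<longleftrightarrow>
     (\<forall>v. v \<noteq> 0 \<longrightarrow> (\<Sum>i\<in>UNIV. cnj (v $ i) * (A *v v) $ i) \<in> \<real>\<^sub>\<ge>\<^sub>0 - {0})"

definition H2_plus :: "(complex^2^2) set" where
  "H2_plus = {B. positive_definite (Im_matrix B) \<and> invertible (Im_matrix B)}"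

definition G_fun :: "('a::cstar_algebra \<Rightarrow> complex) \<Rightarrow> 'a \<Rightarrow> complex^2^2 \<Rightarrow> complex^2^2" where
  "G_fun \<phi> x B = entrywise \<phi> (matrix_inv (matrix_of_scalars B - hermitization x))"

definition H_fun ::
    "('a::cstar_algebra \<Rightarrow> complex) \<Rightarrow> 'a \<Rightarrow> real \<Rightarrow> complex^2^2 \<Rightarrow> complex^2^2" where
  "H_fun \<phi> x p B = B + p *\<^sub>R matrix_inv (J_mat - G_fun \<phi> x B)"

definition B_mat :: "complex \<Rightarrow> complex \<Rightarrow> complex^2^2" where
  "B_mat lam \<zeta> = vector [vector [\<zeta>, lam], vector [cnj lam, \<zeta>]]"

text \<open>\<^const>\<open>G_fun\<close> and \<^const>\<open>H_fun\<close> are only meaningful on \<^const>\<open>H2_plus\<close>; below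
  they are only evaluated there.\<close>

lemma B_mat_in_H2_plus:
  assumes "Im \<zeta> > 0"
  shows "B_mat lam \<zeta> \<in> H2_plus"
proof -
  let ?t = "complex_of_real (Im \<zeta>)"
  have *: "Im_matrix (B_mat lam \<zeta>) = mat ?t"
    by (auto simp: Im_matrix_def B_mat_def adjoint_matrix_def vec_eq_iff forall_2 mat_def
        complex_eq_iff)
  have "mat ?t ** mat (1 / ?t) = (mat 1 :: complex^2^2)"
    "mat (1 / ?t) ** mat ?t = (mat 1 :: complex^2^2)"
    using assms
    by (auto simp: vec_eq_iff forall_2 mat_def matrix_matrix_mult_def sum_2)
  then have inv: "invertible (mat ?t :: complex^2^2)"
    unfolding invertible_def by blast
  have pos: "complex_of_real r \<in> \<real>\<^sub>\<ge>\<^sub>0 - {0}" if "r > 0" for r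
    using that by simp
  have "positive_definite (mat ?t)"
    unfolding positive_definite_def
  proof (intro allI impI)
    fix v :: "complex^2"
    assume "v \<noteq> 0"
    then have nz: "v $ 1 \<noteq> 0 \<or> v $ 2 \<noteq> 0"
      by (auto simp: vec_eq_iff forall_2)
    have "(\<Sum>i\<in>UNIV. cnj (v $ i) * ((mat ?t :: complex^2^2) *v v) $ i)
        = complex_of_real (Im \<zeta> * ((cmod (v $ 1))\<^sup>2 + (cmod (v $ 2))\<^sup>2))"
      by (simp add: sum_2 matrix_vector_mult_def mat_def complex_norm_square algebra_simps
          del: of_real_power)
    moreover have "Im \<zeta> * ((cmod (v $ 1))\<^sup>2 + (cmod (v $ 2))\<^sup>2) > 0"
      using assms nz by (intro mult_pos_pos) (simp_all add: sum_power2_gt_zero_iff)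
    ultimately show "(\<Sum>i\<in>UNIV. cnj (v $ i) * ((mat ?t :: complex^2^2) *v v) $ i)
        \<in> \<real>\<^sub>\<ge>\<^sub>0 - {0}"
      by (simp only: pos)
  qed
  with inv * show ?thesis
    by (simp add: H2_plus_def)
qed

definition H_entry ::
    "('a::cstar_algebra \<Rightarrow> complex) \<Rightarrow> 'a \<Rightarrow> real \<Rightarrow> 2 \<Rightarrow> 2 \<Rightarrow> complex \<Rightarrow> complex \<Rightarrow> complex" where
  "H_entry \<phi> x p i j lam \<zeta> = H_fun \<phi> x p (B_mat lam \<zeta>) $ i $ j"

text \<open>The limit is taken in the extended reals, since it may be \<open>-\<infinity>\<close>.\<close>

definition D_set :: "('a::cstar_algebra \<Rightarrow> complex) \<Rightarrow> 'a \<Rightarrow> real \<Rightarrow> complex set" where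
  "D_set \<phi> x p =
     {lam. \<exists>L::ereal. ((\<lambda>\<delta>. ereal (Im (H_entry \<phi> x p 1 1 lam (\<i> * of_real \<delta>)) / \<delta>)) \<longlongrightarrow> L)
              (at_right 0) \<and> L < 0}"

definition delta0 :: "('a::cstar_algebra \<Rightarrow> complex) \<Rightarrow> 'a \<Rightarrow> real \<Rightarrow> complex \<Rightarrow> real" where
  "delta0 \<phi> x p lam = (THE \<delta>. \<delta> > 0 \<and> H_entry \<phi> x p 1 1 lam (\<i> * of_real \<delta>) = 0)"

definition h_fun :: "('a::cstar_algebra \<Rightarrow> complex) \<Rightarrow> 'a \<Rightarrow> real \<Rightarrow> complex \<Rightarrow> complex" where
  "h_fun \<phi> x p lam = H_entry \<phi> x p 1 2 lam (\<i> * of_real (delta0 \<phi> x p lam))"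

definition M_set :: "('a::cstar_algebra \<Rightarrow> complex) \<Rightarrow> 'a \<Rightarrow> real \<Rightarrow> complex set" where
  "M_set \<phi> x p = h_fun \<phi> x p ` D_set \<phi> x p"

end

theory Submission
  imports Defs
begin

text \<open>
  For \<open>\<zeta> = \<i> \<delta>\<close> the entries of \<open>G\<^sub>X(B(\<lambda>, \<zeta>))\<close> are combinations of \<open>g = \<phi>(D\<^sup>-\<^sup>1)\<close> and
  \<open>q = \<phi>(x D\<^sup>-\<^sup>1)\<close>, where \<open>D = x\<^sup>2 - 2 a x + c\<close> with \<open>a = Re \<lambda>\<close> and \<open>c = \<delta>\<^sup>2 + \<bar>\<lambda>\<bar>\<^sup>2\<close>. With
  \<open>K = c g - 2 a q + (q\<^sup>2 + 1) / g\<close> one finds \<open>Im H\<^sub>1\<^sub>1 / \<delta> = 1 - p / (K - 2 Im \<lambda>)\<close>. Hence at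
  \<open>\<delta> = \<delta>\<^sub>0(\<lambda>)\<close> the pair \<open>(a, c)\<close> determines \<open>\<lambda>\<close> through \<open>Im \<lambda> = (K - p) / 2\<close>, and there
  \<open>h(\<lambda>) = (q + \<i>) / g\<close>.

  So \<open>\<D>\<close> and \<open>\<M>\<close> are the images of one open set of pairs \<open>(a, c)\<close> under
  \<open>S(a, c) = a + \<i> (K - p) / 2\<close> and \<open>\<Phi>(a, c) = (q + \<i>) / g\<close>, and \<open>h = \<Phi> \<circ> S\<^sup>-\<^sup>1\<close>. Both maps are injective
  with injective derivative: \<open>S\<close> because \<open>K\<close> has positive derivative in \<open>c\<close>, and \<open>\<Phi>\<close> because
  \<open>(-2 q, g)\<close> is the gradient of the function \<open>(a, c) \<mapsto> \<phi>(log D)\<close>. That function is strictly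
  concave, as \<open>\<phi>\<close> is faithful and \<open>x\<close> is not a scalar. Invariance of domain and the inverse
  function theorem give the rest.
\<close>

section \<open>Differentiating inverses: of algebra elements and of maps\<close>

lemma has_derivative_two_sided_inverse:
  fixes D P :: "'a::real_normed_vector \<Rightarrow> 'b::real_normed_algebra_1"
  assumes "open S" "z \<in> S"
    and inv: "\<And>w. w \<in> S \<Longrightarrow> D w * P w = 1 \<and> P w * D w = 1"
    and D: "(D has_derivative D') (at z)"
  shows "(P has_derivative (\<lambda>v. - (P z * D' v * P z))) (at z)"
proof -
  have Sev: "eventually (\<lambda>w. w \<in> S) (at z)"
    using assms(1,2) by (metis eventually_at_topological)
  \<comment> \<open>This resolvent identity yields in turn the local boundedness of
    \<open>P\<close>, its continuity and its first-order expansion.\<close>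
  have diff: "P w - P z = - (P w * (D w - D z) * P z)" if "w \<in> S" for w
  proof -
    have "P w * (D w - D z) * P z = (P w * D w) * P z - P w * (D z * P z)"
      by (simp add: algebra_simps)
    then show ?thesis
      using inv[OF that] inv[OF assms(2)] by simp
  qed
  have contD: "(D \<longlongrightarrow> D z) (at z)"
    using has_derivative_continuous[OF D] by (simp add: isCont_def)
  have nonzero: "norm (P z) > 0"
    using inv[OF assms(2)] by force
  \<comment> \<open>The radius is chosen so that the error in the triangle inequality below is at
    most \<open>norm (P w) / 2\<close>, which the left side absorbs.\<close>
  have "eventually (\<lambda>w. norm (D w - D z) < 1 / (2 * norm (P z))) (at z)"
    using tendstoD[OF contD, of "1 / (2 * norm (P z))"] nonzero by (simp add: dist_norm)
  then have bound: "eventually (\<lambda>w. norm (P w) \<le> 2 * norm (P z)) (at z)"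
    using Sev
  proof eventually_elim
    case (elim w)
    have "norm (P w) = norm (P z + (P w - P z))" by simp
    also have "\<dots> \<le> norm (P z) + norm (P w - P z)" by (rule norm_triangle_ineq)
    also have "norm (P w - P z) \<le> norm (P w) * norm (D w - D z) * norm (P z)"
      unfolding diff[OF elim(2)] norm_minus_cancel
      by (meson norm_mult_ineq mult_right_mono norm_ge_zero order_trans)
    also have "\<dots> \<le> norm (P w) * (1 / (2 * norm (P z))) * norm (P z)"
      using elim(1) by (intro mult_right_mono mult_left_mono) auto
    also have "\<dots> = norm (P w) / 2"
      using nonzero by simp
    finally show ?case by simp
  qed
  have contP: "((\<lambda>w. P w - P z) \<longlongrightarrow> 0) (at z)"
  proof (rule tendsto_0_le)
    show "((\<lambda>w. D w - D z) \<longlongrightarrow> 0) (at z)"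
      using contD by (simp add: LIM_zero)
    show "eventually (\<lambda>w. norm (P w - P z) \<le> norm (D w - D z) * (2 * norm (P z) * norm (P z))) (at z)"
      using Sev bound
    proof eventually_elim
      case (elim w)
      have "norm (P w - P z) \<le> norm (P w) * norm (D w - D z) * norm (P z)"
        unfolding diff[OF elim(1)] norm_minus_cancel
        by (meson norm_mult_ineq mult_right_mono norm_ge_zero order_trans)
      also have "\<dots> \<le> (2 * norm (P z)) * norm (D w - D z) * norm (P z)"
        using elim(2) by (intro mult_right_mono) auto
      finally show ?case by (simp add: algebra_simps)
    qed
  qed
  interpret D': bounded_linear D' using D by (rule has_derivative_bounded_linear)
  obtain B where B: "\<And>v. norm (D' v) \<le> norm v * B"
    using D'.bounded by blast
  have "bounded_linear (\<lambda>v. P z * D' v * P z)"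
    using bounded_linear_mult_left bounded_linear_mult_right D'.bounded_linear_axioms
    by (intro bounded_linear_compose[OF bounded_linear_mult_left]
          bounded_linear_compose[OF bounded_linear_mult_right])
  then have lin: "bounded_linear (\<lambda>v. - (P z * D' v * P z))"
    by (rule bounded_linear_minus)
  have rem: "((\<lambda>w. norm (D w - D z - D' (w - z)) / norm (w - z)) \<longlongrightarrow> 0) (at z)"
    using D unfolding has_derivative_iff_norm by simp
  show ?thesis
    unfolding has_derivative_iff_norm
  proof (intro conjI lin)
    have "((\<lambda>w. (2 * norm (P z) * (norm (D w - D z - D' (w - z)) / norm (w - z))
        + norm (P w - P z) * B) * norm (P z)) \<longlongrightarrow> (2 * norm (P z) * 0 + 0 * B) * norm (P z)) (at z)"
      by (intro tendsto_intros rem tendsto_norm_zero contP)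
    then have lim: "((\<lambda>w. (2 * norm (P z) * (norm (D w - D z - D' (w - z)) / norm (w - z))
        + norm (P w - P z) * B) * norm (P z)) \<longlongrightarrow> 0) (at z)" by simp
    show "((\<lambda>w. norm (P w - P z - - (P z * D' (w - z) * P z)) / norm (w - z)) \<longlongrightarrow> 0) (at z)"
    proof (rule tendsto_sandwich[OF _ _ tendsto_const lim])
      show "eventually (\<lambda>w. norm (P w - P z - - (P z * D' (w - z) * P z)) / norm (w - z)
        \<le> (2 * norm (P z) * (norm (D w - D z - D' (w - z)) / norm (w - z))
        + norm (P w - P z) * B) * norm (P z)) (at z)"
        using Sev bound eventually_neq_at_within[of z z UNIV]
      proof eventually_elim
        case (elim w)
        let ?r = "D w - D z - D' (w - z)"
        have pos: "norm (w - z) > 0" using elim(3) by simp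
        \<comment> \<open>Up to the right factor \<open>P z\<close>, the error is \<open>P w\<close>
          times the remainder of \<open>D\<close>, small by differentiability, plus the cost of
          replacing \<open>P z\<close> by \<open>P w\<close> before \<open>D'\<close>, small by
          continuity of \<open>P\<close>.\<close>
        have "P w - P z - - (P z * D' (w - z) * P z)
            = - ((P w * ?r + (P w - P z) * D' (w - z)) * P z)"
          by (subst diff[OF elim(1)]) (simp add: algebra_simps)
        then have "norm (P w - P z - - (P z * D' (w - z) * P z))
            \<le> norm (P w * ?r + (P w - P z) * D' (w - z)) * norm (P z)"
          by (simp add: norm_mult_ineq)
        also have "\<dots> \<le> (norm (P w) * norm ?r + norm (P w - P z) * norm (D' (w - z))) * norm (P z)"
          by (intro mult_right_mono norm_triangle_le add_mono norm_mult_ineq) auto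
        also have "\<dots> \<le> (2 * norm (P z) * norm ?r + norm (P w - P z) * (norm (w - z) * B)) * norm (P z)"
          using elim(2) B by (intro mult_right_mono add_mono mult_left_mono) auto
        finally show ?case
          using pos by (simp add: field_simps)
      qed
    qed simp
  qed
qed

text \<open>Invariance of domain makes the image open. In finite dimension the injective derivative
  is invertible, so the inverse function theorem applies at each point.\<close>

lemma inverse_differentiable_on_image:
  fixes f :: "'a::euclidean_space \<Rightarrow> 'a"
  assumes "open U" and inj: "inj_on f U"
    and der: "\<And>z. z \<in> U \<Longrightarrow> (f has_derivative f' z) (at z)"
    and ker: "\<And>z v. z \<in> U \<Longrightarrow> f' z v = 0 \<Longrightarrow> v = 0"
  shows "open (f ` U)" and "inv_into U f differentiable_on f ` U"
proof -
  have cont: "continuous_on U f"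
    using der by (meson continuous_at_imp_continuous_on has_derivative_continuous)
  show "open (f ` U)"
    by (rule invariance_of_domain[OF cont assms(1) inj])
  show "inv_into U f differentiable_on f ` U"
    unfolding differentiable_on_def
  proof safe
    fix z assume z: "z \<in> U"
    have lin: "linear (f' z)"
      using der[OF z] has_derivative_linear by blast
    have "inj (f' z)"
      using ker[OF z] by (subst linear_injective_0[OF lin]) blast
    then obtain g' where "linear g'" "f' z \<circ> g' = id"
      using lin linear_injective_isomorphism
      by (metis comp_def eq_id_iff)
    then have "(inv_into U f has_derivative g') (at (f z))"
      using der[OF z] inj
      by (intro has_derivative_inverse_strong[OF \<open>open U\<close> z cont]) auto
    then show "inv_into U f differentiable (at (f z) within f ` U)"
      using differentiableI differentiable_at_withinI by blast
  qed
qed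

section \<open>Resolvents in C*-algebras\<close>

lemma scaleC_of_real_1 [simp]: "complex_of_real r *\<^sub>C (1::'a::cstar_algebra) = r *\<^sub>R 1"
  by (rule scaleC_of_real)

lemma scaleC_one [simp]: "1 *\<^sub>C (a::'a::cstar_algebra) = a"
  using scaleC_of_real[of 1 a] by simp

lemma scaleC_zero_left [simp]: "0 *\<^sub>C (a::'a::cstar_algebra) = 0"
  using scaleC_of_real[of 0 a] by simp

lemma star_scaleR: "star (r *\<^sub>R (a::'a::cstar_algebra)) = r *\<^sub>R star a"
  using star_scaleC[of "complex_of_real r" a] by (simp add: scaleC_of_real)

lemma star_one [simp]: "star (1::'a::cstar_algebra) = 1"
  by (metis mult_1 mult_1_right star_mult star_star)

lemma scaleC_minus_left: "(- c) *\<^sub>C (a::'a::cstar_algebra) = - (c *\<^sub>C a)"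
  by (metis add.inverse_unique add_eq_0_iff scaleC_add_left scaleC_zero_left)

lemma scaleC_diff_right: "c *\<^sub>C ((a::'a::cstar_algebra) - b) = c *\<^sub>C a - c *\<^sub>C b"
  using scaleC_add_right[of c "a - b" b] by (simp add: algebra_simps)

lemma star_minus: "star (- (a::'a::cstar_algebra)) = - star a"
  using star_scaleR[of "-1" a] by simp

lemma star_diff: "star ((a::'a::cstar_algebra) - b) = star a - star b"
  using star_add[of a "- b"] by (simp add: star_minus)

lemma one_minus_invertible:
  fixes y :: "'a::{real_normed_algebra_1,banach}"
  assumes "norm y < 1"
  shows "\<exists>z. z * (1 - y) = 1 \<and> (1 - y) * z = 1"
proof (intro exI conjI)
  have sm: "summable (\<lambda>n. y ^ n)"
    by (rule complete_algebra_summable_geometric[OF assms])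
  have S: "(\<Sum>n. y ^ n) = 1 + (\<Sum>n. y ^ Suc n)"
    using suminf_split_head[OF sm] by simp
  have "(\<Sum>n. y ^ Suc n) = y * (\<Sum>n. y ^ n)"
    using suminf_mult[OF sm] by simp
  with S show "(1 - y) * (\<Sum>n. y ^ n) = 1"
    by (simp add: algebra_simps)
  have "(\<Sum>n. y ^ Suc n) = (\<Sum>n. y ^ n) * y"
    using suminf_mult2[OF sm] by (simp add: power_commutes)
  with S show "(\<Sum>n. y ^ n) * (1 - y) = 1"
    by (simp add: algebra_simps)
qed

lemma scalar_minus_invertible:
  fixes y :: "'a::cstar_algebra"
  assumes "norm y < cmod k"
  shows "\<exists>z. z * (k *\<^sub>C 1 - y) = 1 \<and> (k *\<^sub>C 1 - y) * z = 1"
proof -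
  have k: "k \<noteq> 0" using assms by auto
  have "norm (inverse k *\<^sub>C y) < 1"
    using assms k by (simp add: norm_scaleC norm_inverse norm_divide divide_simps)
  then obtain z where z: "z * (1 - inverse k *\<^sub>C y) = 1" "(1 - inverse k *\<^sub>C y) * z = 1"
    using one_minus_invertible by blast
  have *: "k *\<^sub>C 1 - y = k *\<^sub>C 1 * (1 - inverse k *\<^sub>C y)"
    using k by (simp add: algebra_simps mult_scaleC_left scaleC_scaleC)
  have **: "k *\<^sub>C 1 * a = a * (k *\<^sub>C 1)" for a :: 'a
    by (simp add: mult_scaleC_left mult_scaleC_right)
  have kk: "inverse k *\<^sub>C 1 * (k *\<^sub>C 1) = (1::'a)" "k *\<^sub>C 1 * (inverse k *\<^sub>C 1) = (1::'a)"
    using k by (simp_all add: mult_scaleC_left scaleC_scaleC)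
  show ?thesis
  proof (intro exI conjI)
    show "(z * (inverse k *\<^sub>C 1)) * (k *\<^sub>C 1 - y) = 1"
      using kk(1) z(1) by (simp add: * mult.assoc[symmetric]) (simp add: mult.assoc)
    show "(k *\<^sub>C 1 - y) * (z * (inverse k *\<^sub>C 1)) = 1"
      using kk(2) z(2) by (simp add: * mult.assoc) (simp add: mult.assoc[symmetric])
  qed
qed

text \<open>Shifting by a large imaginary \<open>\<i> t\<close> makes the Neumann series applicable, because
  \<open>\<parallel>x + \<i> t\<parallel>\<^sup>2 \<le> \<parallel>x\<parallel>\<^sup>2 + t\<^sup>2\<close> by the C*-identity.\<close>

lemma selfadjoint_resolvent:
  fixes x :: "'a::cstar_algebra"
  assumes x: "selfadjoint x" and w: "Im w > 0"
  shows "\<exists>z. z * (w *\<^sub>C 1 - x) = 1 \<and> (w *\<^sub>C 1 - x) * z = 1"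
proof -
  \<comment> \<open>With this \<open>t\<close> the cross term \<open>2 * (Im w * t)\<close> is twice
    the square of \<open>norm x\<close>, enough for \<open>w + \<i> t\<close> to exceed the shifted
    element in modulus.\<close>
  define t where "t = (norm x)\<^sup>2 / Im w"
  let ?y = "x + (\<i> * of_real t) *\<^sub>C 1"
  have st: "star ?y = x - (\<i> * of_real t) *\<^sub>C 1"
    using x by (simp add: selfadjoint_def star_add star_scaleC scaleC_minus_left)
  have "star ?y * ?y = x * x + (t\<^sup>2) *\<^sub>R 1"
  proof -
    let ?s = "(\<i> * of_real t) *\<^sub>C (1::'a)"
    have "(\<i> * of_real t) * (\<i> * of_real t) = complex_of_real (- t\<^sup>2)"
      by (simp add: power2_eq_square algebra_simps)
    then have "?s * ?s = (- t\<^sup>2) *\<^sub>R 1"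
      by (simp only: mult_scaleC_left mult_1_left scaleC_scaleC scaleC_of_real_1)
    moreover have "?s * x = x * ?s"
      by (simp add: mult_scaleC_left mult_scaleC_right)
    ultimately show ?thesis
      unfolding st by (simp add: ring_distribs)
  qed
  then have "(norm ?y)\<^sup>2 \<le> (norm x)\<^sup>2 + t\<^sup>2"
    using cstar_identity[of ?y] norm_triangle_ineq[of "x * x" "(t\<^sup>2) *\<^sub>R 1"] norm_mult_ineq[of x x]
    by (simp add: power2_eq_square)
  also have "\<dots> < (cmod (w + \<i> * of_real t))\<^sup>2"
  proof -
    have "Im w * t = (norm x)\<^sup>2" using w by (simp add: t_def)
    moreover have "(Im w)\<^sup>2 > 0" using w by simp
    moreover have "(cmod (w + \<i> * of_real t))\<^sup>2 = (Re w)\<^sup>2 + (Im w)\<^sup>2 + 2 * (Im w * t) + t\<^sup>2"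
      unfolding cmod_power2 by (simp add: power2_eq_square algebra_simps)
    ultimately show ?thesis
      using zero_le_power2[of "Re w"] zero_le_power2[of "norm x"] by linarith
  qed
  finally have "norm ?y < cmod (w + \<i> * of_real t)"
    by (rule power2_less_imp_less) simp
  from scalar_minus_invertible[OF this] show ?thesis
    by (simp add: scaleC_add_left)
qed

section \<open>The trace of the resolvent\<close>

text \<open>A normal state lies in the predual, whose elements are bounded functionals.\<close>

lemma wstar_bounded_linear:
  assumes "wstar_probability_space \<phi>"
  shows "bounded_linear \<phi>"
  using assms blinfun.bounded_linear_right unfolding wstar_probability_space_def by blast

text \<open>Polarization: expanding \<open>star (1 + a) * (1 + a)\<close> writes
  \<open>\<phi> a\<close> as a real combination of values of \<open>\<phi>\<close> at elements
  \<open>star u * u\<close>.\<close>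

lemma state_of_selfadjoint:
  assumes "state \<phi>" "selfadjoint a"
  shows "\<phi> a \<in> \<real>"
proof -
  have lin: "\<phi> (u + v) = \<phi> u + \<phi> v" "\<phi> (c *\<^sub>C u) = c * \<phi> u" for u v c
    using assms(1) by (auto simp: state_def clinear_functional_def)
  have pos: "\<phi> (star u * u) \<in> \<real>" for u
    using assms(1) nonneg_Reals_subset_Reals by (auto simp: state_def)
  have "star (1 + a) * (1 + a) = star a * a + (2 *\<^sub>C a + 1)"
    using assms(2) scaleC_of_real[of 2 a]
    by (simp add: selfadjoint_def star_add algebra_simps scaleR_2)
  then have "\<phi> (star (1 + a) * (1 + a)) = \<phi> (star a * a) + 2 * \<phi> a + 1"
    using lin assms(1) by (simp add: state_def)
  then have "\<phi> a = (\<phi> (star (1 + a) * (1 + a)) - \<phi> (star a * a) - 1) / 2"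
    by simp
  then show ?thesis
    using pos by (metis Reals_1 Reals_diff Reals_divide Reals_numeral)
qed

text \<open>The moments of a scalar give \<open>\<mu>\<close> variance zero about \<open>r\<close>.
  Read backwards, a distribution that is not a point mass forces \<open>x\<close> to be
  nonscalar.\<close>

lemma distribution_of_scalar:
  assumes "state \<phi>" "has_distribution \<phi> (r *\<^sub>R 1) \<mu>"
  shows "\<mu> = return borel r"
proof -
  interpret prob_space \<mu>
    using assms(2) by (simp add: has_distribution_def)
  have sets [measurable_cong, simp]: "sets \<mu> = sets borel"
    using assms(2) by (simp add: has_distribution_def)
  obtain R where R: "AE t in \<mu>. \<bar>t\<bar> \<le> R"
    using assms(2) by (auto simp: has_distribution_def)
  have "\<phi> ((r *\<^sub>R 1) ^ n) = of_real (r ^ n)" for n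
  proof -
    have "(r *\<^sub>R (1::'a)) ^ n = of_real (r ^ n) *\<^sub>C 1"
      by (simp only: scaleC_of_real) (simp add: scaleR_power)
    then show ?thesis
      using assms(1) by (simp only: state_def clinear_functional_def mult_1_right)
  qed
  then have mom: "(\<integral>t. t ^ n \<partial>\<mu>) = r ^ n" for n
    using assms(2) unfolding has_distribution_def by (metis of_real_eq_iff)
  have int: "integrable \<mu> (\<lambda>t. t ^ n)" for n
  proof (rule integrable_const_bound)
    show "AE t in \<mu>. norm (t ^ n) \<le> R ^ n"
      using R by eventually_elim (simp add: power_abs power_mono)
  qed simp
  have eq: "(t - r)\<^sup>2 = t ^ 2 - 2 * r * t ^ 1 + r\<^sup>2" for t
    by (simp add: power2_diff)
  have int2: "integrable \<mu> (\<lambda>t. (t - r)\<^sup>2)"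
    unfolding eq by (intro Bochner_Integration.integrable_add Bochner_Integration.integrable_diff
        integrable_mult_right int) simp
  have "(\<integral>t. (t - r)\<^sup>2 \<partial>\<mu>)
      = (\<integral>t. t ^ 2 \<partial>\<mu>) - 2 * r * (\<integral>t. t ^ 1 \<partial>\<mu>) + r\<^sup>2"
    unfolding eq using int[of 1] int[of 2] by (simp add: prob_space)
  then have "(\<integral>t. (t - r)\<^sup>2 \<partial>\<mu>) = 0"
    unfolding mom by (simp add: power2_eq_square)
  then have "AE t in \<mu>. (t - r)\<^sup>2 = 0"
    using integral_nonneg_eq_0_iff_AE[OF int2] by simp
  then have "AE t in \<mu>. t = r"
    by simp
  then have "\<mu> = return \<mu> r"
    by (rule AE_eq_constD)
  also have "\<dots> = return borel r"
    by (rule return_cong) simp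
  finally show ?thesis .
qed

locale selfadjoint_nonscalar =
  fixes \<phi> :: "'a::cstar_algebra \<Rightarrow> complex" and x :: 'a
  assumes state: "state \<phi>" and faithful: "faithful \<phi>" and bounded_linear: "bounded_linear \<phi>"
    and selfadjoint: "selfadjoint x" and nonscalar: "x \<noteq> r *\<^sub>R 1"
begin

text \<open>The point \<open>z\<close> encodes the polynomial \<open>t\<^sup>2 - 2 (Re z) t + Im z\<close>, which has no real root exactly
  on \<open>\<Omega>\<close>.\<close>

definition \<Omega> :: "complex set" where
  "\<Omega> = {z. (Re z)\<^sup>2 < Im z}"

definition quad :: "complex \<Rightarrow> 'a" where
  "quad z = x * x - (2 * Re z) *\<^sub>R x + Im z *\<^sub>R 1"

definition quad_inv :: "complex \<Rightarrow> 'a" where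
  "quad_inv z = (SOME y. quad z * y = 1 \<and> y * quad z = 1)"

definition g :: "complex \<Rightarrow> real" where
  "g z = Re (\<phi> (quad_inv z))"

definition q :: "complex \<Rightarrow> real" where
  "q z = Re (\<phi> (x * quad_inv z))"

text \<open>The partial derivatives of \<open>g\<close> and \<open>q\<close> are linear in these
  moments of the squared inverse.\<close>

definition E :: "nat \<Rightarrow> complex \<Rightarrow> real" where
  "E n z = Re (\<phi> (x ^ n * quad_inv z * quad_inv z))"

sublocale bounded_linear \<phi> by (rule bounded_linear)

lemma phi_scaleC: "\<phi> (c *\<^sub>C a) = c * \<phi> a"
  using state by (simp add: state_def clinear_functional_def)

lemma star_x: "star x = x"
  using selfadjoint by (simp add: selfadjoint_def)

lemma open_Omega: "open \<Omega>"
  unfolding \<Omega>_def by (intro open_Collect_less continuous_intros)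

lemma phi_of_selfadjoint: "star a = a \<Longrightarrow> \<phi> a = of_real (Re (\<phi> a))"
  using state_of_selfadjoint[OF state] by (simp add: selfadjoint_def complex_eq_iff complex_is_Real_iff)

lemma phi_pos: "a \<noteq> 0 \<Longrightarrow> Re (\<phi> (star a * a)) > 0"
proof -
  assume "a \<noteq> 0"
  then have "\<phi> (star a * a) \<noteq> 0"
    using faithful by (auto simp: faithful_def)
  moreover have "\<phi> (star a * a) \<in> \<real>\<^sub>\<ge>\<^sub>0"
    using state by (simp add: state_def)
  ultimately show ?thesis
    by (auto simp: complex_nonneg_Reals_iff complex_eq_iff)
qed

text \<open>The polynomial has conjugate roots \<open>w\<close> and \<open>cnj w\<close> off the
  real axis, so \<open>quad z\<close> factors into two invertible resolvent denominators. If
  \<open>R\<close> inverts one factor, \<open>star R\<close> inverts the other.\<close>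

lemma quad_invertible:
  assumes "z \<in> \<Omega>"
  shows "\<exists>y. quad z * y = 1 \<and> y * quad z = 1"
proof -
  define w where "w = Complex (Re z) (sqrt (Im z - (Re z)\<^sup>2))"
  have "Im w > 0"
    using assms by (simp add: w_def \<Omega>_def)
  then obtain R where R: "R * (w *\<^sub>C 1 - x) = 1" "(w *\<^sub>C 1 - x) * R = 1"
    using selfadjoint_resolvent selfadjoint by blast
  have R': "star R * (cnj w *\<^sub>C 1 - x) = 1" "(cnj w *\<^sub>C 1 - x) * star R = 1"
    using arg_cong[OF R(1), of star] arg_cong[OF R(2), of star] star_x
    by (simp_all add: star_mult star_diff star_scaleC)
  have wc: "w * cnj w = complex_of_real (Im z)" "w + cnj w = complex_of_real (2 * Re z)"
    using assms by (simp_all add: complex_eq_iff w_def \<Omega>_def flip: power2_eq_square)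
  have "(w *\<^sub>C 1 - x) * (cnj w *\<^sub>C 1 - x) = (w * cnj w) *\<^sub>C 1 - (w + cnj w) *\<^sub>C x + x * x"
    by (simp add: ring_distribs mult_scaleC_left mult_scaleC_right scaleC_scaleC scaleC_add_left scaleC_diff_right mult.commute)
  then have q1: "quad z = (w *\<^sub>C 1 - x) * (cnj w *\<^sub>C 1 - x)"
    unfolding wc scaleC_of_real by (simp add: quad_def)
  have q2: "quad z * (star R * R) = 1"
    unfolding q1 using R(2) R'(2) by (metis mult.assoc mult_1_right)
  have q3: "(star R * R) * quad z = 1"
    unfolding q1 using R(1) R'(1) by (metis mult.assoc mult_1_left)
  show ?thesis using q2 q3 by blast
qed

lemma quad_inv:
  assumes "z \<in> \<Omega>"
  shows "quad z * quad_inv z = 1" "quad_inv z * quad z = 1"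
  using someI_ex[OF quad_invertible[OF assms]] by (auto simp: quad_inv_def)

lemma quad_inv_unique:
  assumes "z \<in> \<Omega>" "quad z * y = 1"
  shows "y = quad_inv z"
  by (metis assms mult.assoc mult_1_left mult_1_right quad_inv(2))

lemma star_quad: "star (quad z) = quad z"
  by (simp add: quad_def star_add star_diff star_mult star_scaleR star_x)

lemma star_quad_inv:
  assumes "z \<in> \<Omega>"
  shows "star (quad_inv z) = quad_inv z"
  using arg_cong[OF quad_inv(2)[OF assms], of star]
  by (intro quad_inv_unique[OF assms]) (simp add: star_mult star_quad)

lemma quad_inv_commute:
  assumes "z \<in> \<Omega>"
  shows "quad_inv z * x = x * quad_inv z"
proof -
  have "quad z * x = x * quad z"
    by (simp add: quad_def algebra_simps)
  then show ?thesis
    by (metis assms mult.assoc mult_1_left mult_1_right quad_inv)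
qed

lemma phi_quad_inv:
  assumes "z \<in> \<Omega>"
  shows "\<phi> (quad_inv z) = of_real (g z)" "\<phi> (x * quad_inv z) = of_real (q z)"
  unfolding g_def q_def using star_quad_inv[OF assms]
  by (auto simp: star_mult star_x quad_inv_commute[OF assms] intro!: phi_of_selfadjoint)

text \<open>The form is \<open>\<phi> (star u * u)\<close> for
  \<open>u = (\<alpha> + \<beta> x) * quad_inv z\<close>. This \<open>u\<close> is nonzero because
  \<open>x\<close> is not a scalar, and faithfulness does the rest. All strict inequalities for
  \<open>g\<close>, \<Phi> and the derivative of \<open>K\<close> rest on this.\<close>

lemma E_form_pos:
  assumes z: "z \<in> \<Omega>" and nz: "\<alpha> \<noteq> 0 \<or> \<beta> \<noteq> 0"
  shows "\<alpha>\<^sup>2 * E 0 z + 2 * \<alpha> * \<beta> * E 1 z + \<beta>\<^sup>2 * E 2 z > 0"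
proof -
  let ?l = "\<alpha> *\<^sub>R 1 + \<beta> *\<^sub>R x" and ?P = "quad_inv z"
  have "?l \<noteq> 0"
  proof
    assume l: "?l = 0"
    then have "\<beta> \<noteq> 0" using nz by auto
    moreover have "\<beta> *\<^sub>R x = (- \<alpha>) *\<^sub>R 1"
      using l by (simp add: add_eq_0_iff)
    then have "(1 / \<beta>) *\<^sub>R \<beta> *\<^sub>R x = (1 / \<beta>) *\<^sub>R (- \<alpha>) *\<^sub>R 1"
      by simp
    ultimately have "x = (- \<alpha> / \<beta>) *\<^sub>R 1"
      by simp
    then show False using nonscalar by blast
  qed
  moreover have "(?l * ?P) * quad z = ?l"
    by (simp add: mult.assoc quad_inv(2)[OF z])
  ultimately have "?l * ?P \<noteq> 0" by auto
  note phi_pos[OF this]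
  also have "star (?l * ?P) * (?l * ?P) = \<alpha>\<^sup>2 *\<^sub>R (?P * ?P) + (2 * \<alpha> * \<beta>) *\<^sub>R (x * ?P * ?P) + \<beta>\<^sup>2 *\<^sub>R (x * x * ?P * ?P)"
  proof -
    have "star (?l * ?P) * (?l * ?P) = ?P * (?l * ?l) * ?P"
      using star_quad_inv[OF z] by (simp add: star_mult star_add star_scaleR star_x mult.assoc)
    also have "?P * (?l * ?l) = (?l * ?l) * ?P"
    proof -
      have "?P * ?l = ?l * ?P" using quad_inv_commute[OF z] by (simp add: algebra_simps)
      then show ?thesis by (metis mult.assoc)
    qed
    also have "?l * ?l = \<alpha>\<^sup>2 *\<^sub>R 1 + (2 * \<alpha> * \<beta>) *\<^sub>R x + \<beta>\<^sup>2 *\<^sub>R (x * x)"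
      by (simp add: algebra_simps power2_eq_square flip: scaleR_add_left)
    finally show ?thesis by (simp add: algebra_simps)
  qed
  finally show ?thesis
    by (simp add: E_def add scaleR power2_eq_square)
qed

text \<open>Write the inverse as \<open>quad z\<close> times its square and expand
  \<open>quad z\<close>.\<close>

lemma g_eq:
  assumes z: "z \<in> \<Omega>"
  shows "g z = Im z * E 0 z - 2 * Re z * E 1 z + E 2 z"
proof -
  have "quad_inv z = quad z * quad_inv z * quad_inv z"
    by (simp add: quad_inv[OF z])
  then have "g z = Re (\<phi> (quad z * quad_inv z * quad_inv z))"
    unfolding g_def by (rule arg_cong)
  then show ?thesis
    by (simp add: quad_def E_def add diff scaleR algebra_simps power2_eq_square)
qed

lemma E0_pos: "z \<in> \<Omega> \<Longrightarrow> E 0 z > 0"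
  using E_form_pos[of z 1 0] by simp

text \<open>Complete the square: the polynomial is the square of \<open>t - Re z\<close> plus a
  positive constant.\<close>

lemma g_pos:
  assumes "z \<in> \<Omega>"
  shows "g z > 0"
proof -
  have "g z = ((- Re z)\<^sup>2 * E 0 z + 2 * (- Re z) * 1 * E 1 z + 1\<^sup>2 * E 2 z) + (Im z - (Re z)\<^sup>2) * E 0 z"
    unfolding g_eq[OF assms] by (simp add: algebra_simps)
  also have "\<dots> > 0"
    using assms E0_pos[OF assms]
    by (intro add_pos_pos E_form_pos mult_pos_pos) (auto simp: \<Omega>_def)
  finally show ?thesis .
qed

section \<open>Derivatives of \<open>g\<close> and \<open>q\<close>\<close>

lemma quad_has_derivative:
  "(quad has_derivative (\<lambda>v. Im v *\<^sub>R 1 - (2 * Re v) *\<^sub>R x)) (at z)"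
proof -
  have "((\<lambda>w. x * x - (2 * Re w) *\<^sub>R x + Im w *\<^sub>R 1) has_derivative
    (\<lambda>v. 0 - (2 * Re v) *\<^sub>R x + Im v *\<^sub>R 1)) (at z)"
    by (intro has_derivative_add has_derivative_diff has_derivative_const has_derivative_scaleR_left
        has_derivative_mult_right has_derivative_Re has_derivative_Im has_derivative_ident)
  then show ?thesis
    by (simp add: quad_def[abs_def])
qed

lemma quad_inv_has_derivative:
  assumes "z \<in> \<Omega>"
  shows "(quad_inv has_derivative
    (\<lambda>v. - (quad_inv z * (Im v *\<^sub>R 1 - (2 * Re v) *\<^sub>R x) * quad_inv z))) (at z)"
  by (rule has_derivative_two_sided_inverse[OF open_Omega assms _ quad_has_derivative])
    (simp add: quad_inv)

lemma quad_inv_sandwich: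
  assumes "z \<in> \<Omega>"
  shows "x ^ n * (quad_inv z * (c *\<^sub>R 1 - r *\<^sub>R x) * quad_inv z)
    = c *\<^sub>R (x ^ n * quad_inv z * quad_inv z) - r *\<^sub>R (x ^ Suc n * quad_inv z * quad_inv z)"
proof -
  have "quad_inv z * (c *\<^sub>R 1 - r *\<^sub>R x) = (c *\<^sub>R 1 - r *\<^sub>R x) * quad_inv z"
    using quad_inv_commute[OF assms] by (simp add: ring_distribs)
  then show ?thesis
    by (simp only: power_Suc2 left_diff_distrib right_diff_distrib mult.assoc mult_scaleR_left
        mult_scaleR_right mult_1_left)
qed

lemma g_has_derivative:
  assumes "z \<in> \<Omega>"
  shows "(g has_derivative (\<lambda>v. - (Im v * E 0 z - 2 * Re v * E 1 z))) (at z)"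
proof -
  have "bounded_linear (\<lambda>a. Re (\<phi> a))"
    by (rule bounded_linear_compose[OF bounded_linear_Re bounded_linear])
  from bounded_linear.has_derivative[OF this quad_inv_has_derivative[OF assms]]
  show ?thesis
    unfolding g_def
    by (rule has_derivative_eq_rhs)
      (use quad_inv_sandwich[OF assms, of 0] in \<open>simp add: fun_eq_iff E_def neg diff scaleR\<close>)
qed

lemma q_has_derivative:
  assumes "z \<in> \<Omega>"
  shows "(q has_derivative (\<lambda>v. - (Im v * E 1 z - 2 * Re v * E 2 z))) (at z)"
proof -
  have "bounded_linear (\<lambda>a. Re (\<phi> (x * a)))"
    by (rule bounded_linear_compose[OF bounded_linear_compose[OF bounded_linear_Re bounded_linear]
        bounded_linear_mult_right])
  from bounded_linear.has_derivative[OF this quad_inv_has_derivative[OF assms]]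
  show ?thesis
    unfolding q_def
    by (rule has_derivative_eq_rhs)
      (use quad_inv_sandwich[OF assms, of 1] in
        \<open>simp add: fun_eq_iff E_def neg diff scaleR numeral_2_eq_2\<close>)
qed

end

section \<open>Two injective maps of the parabolic domain\<close>

lemma has_derivative_Complex:
  assumes "(f has_derivative f') F" "(g has_derivative g') F"
  shows "((\<lambda>z. Complex (f z) (g z)) has_derivative (\<lambda>v. Complex (f' v) (g' v))) F"
  unfolding Complex_eq by (intro derivative_intros assms)

context selfadjoint_nonscalar
begin

definition \<Phi> :: "complex \<Rightarrow> complex" where
  "\<Phi> z = Complex (q z / g z) (1 / g z)"

definition K :: "complex \<Rightarrow> real" where
  "K z = Im z * g z - 2 * Re z * q z + ((q z)\<^sup>2 + 1) / g z"

definition g' :: "complex \<Rightarrow> complex \<Rightarrow> real" where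
  "g' z v = - (Im v * E 0 z - 2 * Re v * E 1 z)"

definition q' :: "complex \<Rightarrow> complex \<Rightarrow> real" where
  "q' z v = - (Im v * E 1 z - 2 * Re v * E 2 z)"

definition K' :: "complex \<Rightarrow> complex \<Rightarrow> real" where
  "K' z v = Im v * g z + Im z * g' z v - 2 * (Re v * q z + Re z * q' z v)
    + 2 * q z * q' z v / g z - ((q z)\<^sup>2 + 1) * g' z v / (g z)\<^sup>2"

lemmas g_der [derivative_intros] = g_has_derivative[folded g'_def]
lemmas q_der [derivative_intros] = q_has_derivative[folded q'_def]

text \<open>The left side is the second derivative of \<open>\<phi> (log D)\<close> in direction
  \<open>v\<close>. It equals minus the form of \<open>E_form_pos\<close> at
  \<open>(Im v, - 2 * Re v)\<close>.\<close>

lemma gradient_form_neg: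
  assumes "z \<in> \<Omega>" "v \<noteq> 0"
  shows "Im v * g' z v - 2 * Re v * q' z v < 0"
  using E_form_pos[OF assms(1), of "Im v" "- 2 * Re v"] assms(2)
  by (auto simp: g'_def q'_def complex_eq_iff algebra_simps power2_eq_square)

lemma \<Phi>_has_derivative:
  assumes "z \<in> \<Omega>"
  shows "(\<Phi> has_derivative (\<lambda>v. Complex ((q' z v * g z - q z * g' z v) / (g z * g z))
    ((0 * g z - 1 * g' z v) / (g z * g z)))) (at z)"
  using g_pos[OF assms] unfolding \<Phi>_def
  by (intro has_derivative_Complex has_derivative_divide' g_der[OF assms] q_der[OF assms] has_derivative_const) auto

text \<open>The second component kills \<open>g'\<close>, then the first kills \<open>q'\<close>,
  against strict concavity. The quotients keep the unsimplified shape of the quotient rule to match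
  \<open>\<Phi>_has_derivative\<close>.\<close>

lemma \<Phi>_derivative_kernel:
  assumes "z \<in> \<Omega>"
    and "Complex ((q' z v * g z - q z * g' z v) / (g z * g z)) ((0 * g z - 1 * g' z v) / (g z * g z)) = 0"
  shows "v = 0"
proof (rule ccontr)
  assume "v \<noteq> 0"
  moreover have "g' z v = 0" "q' z v = 0"
    using assms(2) g_pos[OF assms(1)] by (auto simp: complex_eq_iff)
  ultimately show False
    using gradient_form_neg[OF assms(1), of v] by simp
qed

text \<open>The region lies strictly above a parabola. Convexity keeps the segment between two
  points inside \<Omega> in the injectivity argument for \<Phi>.\<close>

lemma convex_Omega: "convex \<Omega>"
proof -
  show ?thesis
    unfolding convex_def \<Omega>_def
  proof clarsimp
    fix z w :: complex and u v :: real
    assume *: "(Re z)\<^sup>2 < Im z" "(Re w)\<^sup>2 < Im w" "0 \<le> u" "0 \<le> v" "u + v = 1"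
    have "(u * Re z + v * Re w)\<^sup>2 \<le> u * (Re z)\<^sup>2 + v * (Re w)\<^sup>2"
      using convex_onD[OF convex_power2, of v "Re z" "Re w"] * by (simp flip: eq_diff_eq)
    also have "\<dots> < u * Im z + v * Im w"
    proof (cases "u = 0")
      case True then show ?thesis using * by simp
    next
      case False
      then have "u * (Re z)\<^sup>2 < u * Im z" using * by simp
      moreover have "v * (Re w)\<^sup>2 \<le> v * Im w" using * by (simp add: mult_left_mono)
      ultimately show ?thesis by simp
    qed
    finally show "(u * Re z + v * Re w)\<^sup>2 < u * Im z + v * Im w" .
  qed
qed

text \<open>The gradient of a strictly concave function is injective: its component along the
  segment from \<open>z\<close> to \<open>w\<close> strictly decreases, yet equal values of \<Phi>
  give equal \<open>g\<close> and \<open>q\<close> at both ends.\<close>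

lemma inj_on_\<Phi>: "inj_on \<Phi> \<Omega>"
proof (rule inj_onI, rule ccontr)
  fix z w assume z: "z \<in> \<Omega>" and w: "w \<in> \<Omega>" and eq: "\<Phi> z = \<Phi> w" and ne: "z \<noteq> w"
  have gq: "g z = g w" "q z = q w"
    using eq g_pos[OF z] g_pos[OF w] by (auto simp: \<Phi>_def)
  define v where "v = w - z"
  define f where "f t = Im v * g (z + t *\<^sub>R v) - 2 * Re v * q (z + t *\<^sub>R v)" for t
  have "f 1 < f 0"
  proof (rule DERIV_neg_imp_decreasing[where f = f and a = 0 and b = 1])
    fix t :: real assume t: "0 \<le> t" "t \<le> 1"
    have "z + t *\<^sub>R v = (1 - t) *\<^sub>R z + t *\<^sub>R w"
      by (simp add: v_def algebra_simps)
    then have in_\<Omega>: "z + t *\<^sub>R v \<in> \<Omega>"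
      using convexD[OF convex_Omega z w, of "1 - t" t] t by simp
    have line: "((\<lambda>t. z + t *\<^sub>R v) has_derivative (\<lambda>s. s *\<^sub>R v)) (at t)"
      by (auto intro!: derivative_eq_intros)
    have "(f has_derivative (\<lambda>s. Im v * g' (z + t *\<^sub>R v) (s *\<^sub>R v) - 2 * Re v * q' (z + t *\<^sub>R v) (s *\<^sub>R v))) (at t)"
      unfolding f_def
      by (intro has_derivative_diff has_derivative_mult_right
          has_derivative_compose[OF line g_der[OF in_\<Omega>]]
          has_derivative_compose[OF line q_der[OF in_\<Omega>]])
    then have "(f has_real_derivative (Im v * g' (z + t *\<^sub>R v) v - 2 * Re v * q' (z + t *\<^sub>R v) v)) (at t)"
      unfolding has_field_derivative_def
      by (rule has_derivative_eq_rhs) (simp add: fun_eq_iff g'_def q'_def algebra_simps)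
    moreover have "v \<noteq> 0" using ne by (simp add: v_def)
    ultimately show "\<exists>y. (f has_real_derivative y) (at t) \<and> y < 0"
      using gradient_form_neg[OF in_\<Omega>] by blast
  qed simp
  then show False
    by (simp add: f_def v_def gq)
qed

section \<open>Monotonicity and growth of \<open>K\<close> along vertical lines\<close>

lemma K_has_derivative:
  assumes "z \<in> \<Omega>"
  shows "(K has_derivative K' z) (at z)"
proof -
  have "((\<lambda>z. Im z * g z - 2 * Re z * q z + ((q z)\<^sup>2 + 1) / g z) has_derivative K' z) (at z)"
    using g_pos[OF assms]
    by (auto intro!: derivative_eq_intros g_der[OF assms] q_der[OF assms]
        simp: assms K'_def fun_eq_iff field_simps power2_eq_square)
  then show ?thesis by (simp add: K_def[abs_def])
qed

text \<open>For vertical \<open>v\<close> the terms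
  \<open>g z - Im z * E 0 z + 2 * Re z * E 1 z\<close> collapse to \<open>E 2 z\<close> by
  \<open>g_eq\<close>. What is left is the form of \<open>E_form_pos\<close> at
  \<open>(- q z / g z, 1)\<close> plus a positive term.\<close>

lemma K'_vertical:
  assumes "z \<in> \<Omega>" "Re v = 0"
  shows "K' z v = Im v * ((q z / g z)\<^sup>2 * E 0 z - 2 * (q z / g z) * E 1 z + E 2 z + E 0 z / (g z)\<^sup>2)"
proof -
  have "K' z v = Im v * ((g z - Im z * E 0 z + 2 * Re z * E 1 z)
      + (q z / g z)\<^sup>2 * E 0 z - 2 * (q z / g z) * E 1 z + E 0 z / (g z)\<^sup>2)"
    using assms(2) g_pos[OF assms(1)]
    by (simp add: K'_def g'_def q'_def field_simps power2_eq_square)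
  then show ?thesis
    by (simp add: g_eq[OF assms(1)])
qed

lemma K'_vertical_pos:
  assumes "z \<in> \<Omega>"
  shows "(q z / g z)\<^sup>2 * E 0 z - 2 * (q z / g z) * E 1 z + E 2 z + E 0 z / (g z)\<^sup>2 > 0"
proof -
  have "E 0 z / (g z)\<^sup>2 > 0"
    using E0_pos[OF assms] g_pos[OF assms] by simp
  then show ?thesis
    using E_form_pos[OF assms, of "- (q z / g z)" 1] by simp
qed

lemma K_strict_mono:
  assumes "Complex a c \<in> \<Omega>" "c < d"
  shows "K (Complex a c) < K (Complex a d)"
proof (rule DERIV_pos_imp_increasing[OF assms(2)])
  fix t assume t: "c \<le> t" "t \<le> d"
  have in_\<Omega>: "Complex a t \<in> \<Omega>" using assms(1) t by (simp add: \<Omega>_def)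
  have line: "(Complex a has_derivative Complex 0) (at t)"
    by (intro has_derivative_Complex has_derivative_const has_derivative_ident)
  have "((\<lambda>t. K (Complex a t)) has_derivative (\<lambda>s. K' (Complex a t) (Complex 0 s))) (at t)"
    by (rule has_derivative_compose[OF line K_has_derivative[OF in_\<Omega>]])
  then have "((\<lambda>t. K (Complex a t)) has_real_derivative K' (Complex a t) (Complex 0 1)) (at t)"
    unfolding has_field_derivative_def
    by (rule has_derivative_eq_rhs) (simp add: fun_eq_iff K'_vertical[OF in_\<Omega>])
  then show "\<exists>y. ((\<lambda>t. K (Complex a t)) has_real_derivative y) (at t) \<and> 0 < y"
    using K'_vertical_pos[OF in_\<Omega>] by (auto simp: K'_vertical[OF in_\<Omega>])
qed

text \<open>Completing the square in \<open>q z\<close> leaves only nonnegative terms besides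
  \<open>1 / g z\<close>.\<close>

lemma K_ge:
  assumes "z \<in> \<Omega>"
  shows "K z \<ge> 1 / g z"
proof -
  have "Im z * g z - 2 * Re z * q z + (q z)\<^sup>2 / g z
      = (Im z - (Re z)\<^sup>2) * g z + (Re z * g z - q z)\<^sup>2 / g z"
    using g_pos[OF assms] by (simp add: field_simps power2_eq_square)
  also have "\<dots> \<ge> 0"
    using g_pos[OF assms] assms by (intro add_nonneg_nonneg) (auto simp: \<Omega>_def)
  finally show ?thesis
    by (simp add: K_def add_divide_distrib)
qed

text \<open>For large \<open>c\<close> the inverse has norm of order \<open>1 / c\<close>, so
  \<open>g\<close> is small and \<open>K_ge\<close> makes \<open>K\<close> large. This supplies the
  upper endpoint when \<open>\<delta>\<^sub>0\<close> is found by the intermediate value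
  theorem.\<close>

lemma K_unbounded: "\<exists>c0. \<forall>c\<ge>c0. Complex a c \<in> \<Omega> \<and> K (Complex a c) \<ge> M"
proof -
  obtain C where C: "C > 0" "\<And>y. norm (\<phi> y) \<le> norm y * C"
    using pos_bounded by blast
  let ?r = "x * x - (2 * a) *\<^sub>R x"
  \<comment> \<open>The three bounds put the point in \<Omega> with \<open>c\<close> positive, give
    the inverse norm at most \<open>2 / c\<close>, and make \<open>c / (2 * C)\<close> at least
    \<open>M\<close>.\<close>
  define c0 where "c0 = Max {a\<^sup>2 + 1, 2 * norm ?r, 2 * C * M}"
  show ?thesis
  proof (intro exI allI impI)
    fix c assume "c \<ge> c0"
    then have c: "c \<ge> a\<^sup>2 + 1" "c \<ge> 2 * norm ?r" "c \<ge> 2 * C * M"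
      by (auto simp: c0_def)
    let ?z = "Complex a c"
    have z: "?z \<in> \<Omega>" using c by (simp add: \<Omega>_def)
    have "c > 0" using c(1) zero_le_power2[of a] by linarith
    have "c *\<^sub>R quad_inv ?z = 1 - ?r * quad_inv ?z"
      using quad_inv(1)[OF z] by (simp add: quad_def algebra_simps)
    then have "norm (c *\<^sub>R quad_inv ?z) \<le> 1 + norm (?r * quad_inv ?z)"
      using norm_triangle_ineq4[of 1 "?r * quad_inv ?z"] by simp
    also have "\<dots> \<le> 1 + norm ?r * norm (quad_inv ?z)"
      by (simp add: norm_mult_ineq)
    also have "\<dots> \<le> 1 + c / 2 * norm (quad_inv ?z)"
      using c(2) by (intro add_left_mono mult_right_mono) auto
    finally have "c * norm (quad_inv ?z) \<le> 2"
      using \<open>c > 0\<close> by simp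
    then have n: "norm (quad_inv ?z) \<le> 2 / c"
      using \<open>c > 0\<close> by (simp add: field_simps)
    have "g ?z \<le> norm (quad_inv ?z) * C"
      unfolding g_def using C(2) complex_Re_le_cmod order_trans by blast
    also have "\<dots> \<le> 2 / c * C"
      using n C(1) by (intro mult_right_mono) auto
    finally have "1 / g ?z \<ge> c / (2 * C)"
      using g_pos[OF z] C(1) \<open>c > 0\<close> by (simp add: field_simps)
    moreover have "c / (2 * C) \<ge> M"
      using c(3) C(1) by (simp add: field_simps)
    ultimately show "?z \<in> \<Omega> \<and> K ?z \<ge> M"
      using z K_ge[OF z] by linarith
  qed
qed

end

section \<open>The matrix-valued functions\<close>

lemma matrix_inv_eqI:
  fixes A B :: "'a::semiring_1^'n^'n"
  assumes "A ** B = mat 1" "B ** A = mat 1"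
  shows "matrix_inv A = B"
proof -
  have "A ** matrix_inv A = mat 1"
    using someI[of "\<lambda>C. A ** C = mat 1 \<and> C ** A = mat 1" B] assms
    by (simp add: matrix_inv_def)
  then show ?thesis
    by (metis assms(2) matrix_mul_assoc matrix_mul_lid matrix_mul_rid)
qed

text \<open>Cramer's rule for commuting entries. As \<open>P\<close> inverts minus the determinant,
  the signs of the adjugate are flipped. It serves over the algebra for \<open>G_fun\<close> and
  over the complex numbers for \<open>H_fun\<close>.\<close>

lemma matrix_inv_2x2_commuting:
  fixes d l m P :: "'a::ring_1"
  assumes "l * d = d * l" "m * d = d * m" "m * l = l * m"
    "P * d = d * P" "P * l = l * P" "P * m = m * P"
    and inv: "(l * m - d * d) * P = 1"
  shows "matrix_inv (vector [vector [d, l], vector [m, d]])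
    = (vector [vector [- (d * P), l * P], vector [m * P, - (d * P)]] :: 'a^2^2)"
proof -
  note comm = assms(1-6)
  have lcomm: "l * (d * y) = d * (l * y)" "m * (d * y) = d * (m * y)" "m * (l * y) = l * (m * y)"
    "P * (d * y) = d * (P * y)" "P * (l * y) = l * (P * y)" "P * (m * y) = m * (P * y)" for y
    using comm by (metis mult.assoc)+
  have "l * (m * P) - d * (d * P) = 1"
    using inv by (simp add: algebra_simps)
  then show ?thesis
    by (intro matrix_inv_eqI)
      (simp_all add: vec_eq_iff forall_2 matrix_matrix_mult_def sum_2 mat_def mult.assoc comm lcomm)
qed

lemma differentiable_on_transform:
  assumes "f differentiable_on A" "\<And>y. y \<in> A \<Longrightarrow> g y = f y"
  shows "g differentiable_on A"
  using assms has_derivative_transform unfolding differentiable_on_def differentiable_def by meson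

context selfadjoint_nonscalar
begin

text \<open>\<open>pt lam \<delta>\<close> encodes \<open>\<delta>\<^sup>2 + \<bar>lam - t\<bar>\<^sup>2\<close>, and \<open>S p\<close> recovers \<open>lam\<close> from it when \<open>\<delta> = \<delta>\<^sub>0(lam)\<close>.\<close>

definition pt :: "complex \<Rightarrow> real \<Rightarrow> complex" where
  "pt lam \<delta> = Complex (Re lam) (\<delta>\<^sup>2 + (cmod lam)\<^sup>2)"

definition S :: "real \<Rightarrow> complex \<Rightarrow> complex" where
  "S p z = Complex (Re z) ((K z - p) / 2)"

text \<open>The inequality says that \<open>z\<close> is \<open>pt (S p z) \<delta>\<close> for some
  positive \<delta>, whose square is the difference of the two sides.\<close>

definition U :: "real \<Rightarrow> complex set" where
  "U p = {z \<in> \<Omega>. (cmod (S p z))\<^sup>2 < Im z}"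

section \<open>The entries of \<open>G_fun\<close> and \<open>H_fun\<close> in terms of
  \<open>g\<close>, \<open>q\<close> and \<open>K\<close>\<close>

lemma pt_in_\<Omega>: "\<delta> > 0 \<Longrightarrow> pt lam \<delta> \<in> \<Omega>"
  by (simp add: pt_def \<Omega>_def cmod_power2 add_pos_nonneg)

text \<open>The right side is minus the determinant of the 2 by 2 matrix whose inverse defines
  \<open>G_fun\<close>, in the form \<open>matrix_inv_2x2_commuting\<close> asks for.\<close>

lemma quad_pt:
  "quad (pt lam \<delta>) = (lam *\<^sub>C 1 - x) * (cnj lam *\<^sub>C 1 - x)
    - ((\<i> * of_real \<delta>) *\<^sub>C 1) * ((\<i> * of_real \<delta>) *\<^sub>C 1)"
proof -
  have "(lam *\<^sub>C 1 - x) * (cnj lam *\<^sub>C 1 - x) = (lam * cnj lam) *\<^sub>C 1 - (lam + cnj lam) *\<^sub>C x + x * x"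
    by (simp add: ring_distribs mult_scaleC_left mult_scaleC_right scaleC_scaleC scaleC_add_left
        scaleC_diff_right mult.commute)
  moreover have "lam * cnj lam = complex_of_real ((cmod lam)\<^sup>2)" "lam + cnj lam = complex_of_real (2 * Re lam)"
    unfolding complex_norm_square by (simp_all add: complex_eq_iff)
  moreover have "((\<i> * of_real \<delta>) *\<^sub>C 1) * ((\<i> * of_real \<delta>) *\<^sub>C 1) = (- \<delta>\<^sup>2) *\<^sub>R (1::'a)"
  proof -
    have "(\<i> * of_real \<delta>) * (\<i> * of_real \<delta>) = complex_of_real (- \<delta>\<^sup>2)"
      by (simp add: power2_eq_square algebra_simps)
    then show ?thesis
      by (simp only: mult_scaleC_left mult_1_left scaleC_scaleC scaleC_of_real_1)
  qed
  ultimately show ?thesis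
    by (simp only: scaleC_of_real) (simp add: quad_def pt_def scaleR_add_left)
qed

lemma G_fun_eq:
  fixes lam :: complex
  assumes "\<delta> > 0"
  defines "z \<equiv> pt lam \<delta>"
  shows "G_fun \<phi> x (B_mat lam (\<i> * of_real \<delta>)) = vector
    [vector [- \<i> * of_real (\<delta> * g z), lam * of_real (g z) - of_real (q z)],
     vector [cnj lam * of_real (g z) - of_real (q z), - \<i> * of_real (\<delta> * g z)]]"
proof -
  let ?d = "(\<i> * of_real \<delta>) *\<^sub>C (1::'a)" and ?l = "lam *\<^sub>C 1 - x" and ?m = "cnj lam *\<^sub>C 1 - x"
  let ?P = "quad_inv z"
  have z: "z \<in> \<Omega>" using pt_in_\<Omega>[OF assms(1)] by (simp add: z_def)
  note sc = mult_scaleC_left mult_scaleC_right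
  have "G_fun \<phi> x (B_mat lam (\<i> * of_real \<delta>))
      = entrywise \<phi> (matrix_inv (vector [vector [?d, ?l], vector [?m, ?d]]))"
    unfolding G_fun_def
    by (intro arg_cong[of _ _ "\<lambda>M. entrywise \<phi> (matrix_inv M)"])
       (simp add: vec_eq_iff forall_2 matrix_of_scalars_def B_mat_def hermitization_def)
  also have "matrix_inv (vector [vector [?d, ?l], vector [?m, ?d]])
      = (vector [vector [- (?d * ?P), ?l * ?P], vector [?m * ?P, - (?d * ?P)]] :: 'a^2^2)"
  proof (rule matrix_inv_2x2_commuting)
    show "(?l * ?m - ?d * ?d) * ?P = 1"
      using quad_inv(1)[OF z] by (simp add: z_def quad_pt)
  qed (simp_all add: quad_inv_commute[OF z] ring_distribs sc scaleC_scaleC scaleC_diff_right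
      mult.commute)
  finally have G: "G_fun \<phi> x (B_mat lam (\<i> * of_real \<delta>))
      = entrywise \<phi> (vector [vector [- (?d * ?P), ?l * ?P], vector [?m * ?P, - (?d * ?P)]])" .
  have "\<phi> (- (?d * ?P)) = - \<i> * of_real (\<delta> * g z)"
    "\<phi> (?l * ?P) = lam * of_real (g z) - of_real (q z)"
    "\<phi> (?m * ?P) = cnj lam * of_real (g z) - of_real (q z)"
    by (simp_all add: neg diff ring_distribs sc phi_scaleC phi_quad_inv[OF z])
  then show ?thesis
    unfolding G by (simp add: entrywise_def vec_eq_iff forall_2)
qed

lemma H_entry_eq:
  fixes lam :: complex
  assumes "\<delta> > 0"
  defines "z \<equiv> pt lam \<delta>"
  shows "K z - 2 * Im lam > 0"
    and "H_entry \<phi> x p 1 1 lam (\<i> * of_real \<delta>) = \<i> * of_real (\<delta> * (1 - p / (K z - 2 * Im lam)))"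
    and "H_entry \<phi> x p 1 2 lam (\<i> * of_real \<delta>)
      = lam + of_real p * (\<i> - lam * of_real (g z) + of_real (q z)) / of_real (g z * (K z - 2 * Im lam))"
proof -
  have z: "z \<in> \<Omega>" using pt_in_\<Omega>[OF assms(1)] by (simp add: z_def)
  note gp = g_pos[OF z]
  let ?d = "\<i> * of_real (\<delta> * g z)" and ?l = "\<i> - lam * of_real (g z) + of_real (q z)"
    and ?m = "- \<i> - cnj lam * of_real (g z) + of_real (q z)"
  let ?Q = "g z * (K z - 2 * Im lam)"
  \<comment> \<open>\<open>?Q\<close> is minus the determinant of \<open>J_mat\<close> minus
    \<open>G_fun\<close>. Since \<open>?m\<close> is the conjugate of \<open>?l\<close>, it is a sum
    of squares, and the last one is positive because \<delta> is.\<close>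
  have Q: "?Q = (q z - Re lam * g z)\<^sup>2 + (1 - Im lam * g z)\<^sup>2 + (\<delta> * g z)\<^sup>2"
    using gp unfolding K_def
    by (simp add: field_simps power2_eq_square)
      (unfold z_def pt_def cmod_power2, simp add: power2_eq_square algebra_simps)
  have "?Q > 0"
    unfolding Q using gp assms(1) by (intro add_nonneg_pos) auto
  then show K: "K z - 2 * Im lam > 0"
    using gp by (simp add: zero_less_mult_iff)
  have det: "?l * ?m - ?d * ?d = of_real ?Q"
    unfolding Q by (simp add: complex_eq_iff power2_eq_square algebra_simps)
  have "J_mat - G_fun \<phi> x (B_mat lam (\<i> * of_real \<delta>)) = vector [vector [?d, ?l], vector [?m, ?d]]"
    unfolding G_fun_eq[OF assms(1)] z_def[symmetric]
    by (simp add: vec_eq_iff forall_2 J_mat_def)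
  moreover have "matrix_inv (vector [vector [?d, ?l], vector [?m, ?d]])
      = (vector [vector [- (?d * (1 / of_real ?Q)), ?l * (1 / of_real ?Q)],
          vector [?m * (1 / of_real ?Q), - (?d * (1 / of_real ?Q))]] :: complex^2^2)"
  proof (rule matrix_inv_2x2_commuting)
    have "of_real r * (1 / of_real r) = (1::complex)" if "r > 0" for r :: real
      using that by simp
    then show "(?l * ?m - ?d * ?d) * (1 / of_real ?Q) = 1"
      unfolding det using \<open>?Q > 0\<close> .
  qed (simp_all only: mult.commute)
  ultimately have H: "H_fun \<phi> x p (B_mat lam (\<i> * of_real \<delta>)) = B_mat lam (\<i> * of_real \<delta>)
      + p *\<^sub>R vector [vector [- (?d * (1 / of_real ?Q)), ?l * (1 / of_real ?Q)],
          vector [?m * (1 / of_real ?Q), - (?d * (1 / of_real ?Q))]]"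
    by (simp add: H_fun_def)
  show "H_entry \<phi> x p 1 1 lam (\<i> * of_real \<delta>) = \<i> * of_real (\<delta> * (1 - p / (K z - 2 * Im lam)))"
    unfolding H_entry_def H using gp K
    by (simp add: B_mat_def) (simp add: scaleR_conv_of_real field_simps)
  show "H_entry \<phi> x p 1 2 lam (\<i> * of_real \<delta>) = lam + of_real p * ?l / of_real ?Q"
    unfolding H_entry_def H
    by (simp add: B_mat_def) (simp add: scaleR_conv_of_real)
qed

section \<open>The zero \<open>\<delta>\<^sub>0\<close> and the set \<open>D_set\<close> as the
  image of \<open>S\<close>\<close>

lemma H_entry_eq_0_iff:
  assumes "\<delta> > 0"
  shows "H_entry \<phi> x p 1 1 lam (\<i> * of_real \<delta>) = 0 \<longleftrightarrow> S p (pt lam \<delta>) = lam"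
  unfolding H_entry_eq(2)[OF assms] using H_entry_eq(1)[OF assms, of lam] assms
  by (auto simp: S_def pt_def complex_eq_iff simp flip: of_real_diff)

lemma K_pt_strict_mono:
  assumes "0 < \<delta>" "\<delta> < \<delta>'"
  shows "K (pt lam \<delta>) < K (pt lam \<delta>')"
  using K_strict_mono[OF pt_in_\<Omega>[OF assms(1), of lam, unfolded pt_def]] assms
  by (simp add: pt_def power_strict_mono)

text \<open>\<open>S p\<close> preserves real parts, and \<open>K\<close> is strictly increasing on
  vertical lines.\<close>

lemma inj_on_S: "inj_on (S p) \<Omega>"
proof (rule inj_onI)
  fix z w assume *: "z \<in> \<Omega>" "w \<in> \<Omega>" "S p z = S p w"
  then have Re: "Re w = Re z" and K: "K z = K w" by (auto simp: S_def)
  then have zw: "z = Complex (Re z) (Im z)" "w = Complex (Re z) (Im w)" by (auto simp: complex_eq_iff)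
  have "\<not> Im z < Im w" "\<not> Im w < Im z"
    using K_strict_mono[of "Re z"] * K zw by (metis less_irrefl)+
  then show "z = w"
    using Re by (simp add: complex_eq_iff)
qed

lemma pt_S:
  assumes "z \<in> U p"
  obtains \<delta> where "\<delta> > 0" "pt (S p z) \<delta> = z"
proof
  show "sqrt (Im z - (cmod (S p z))\<^sup>2) > 0"
    using assms by (simp add: U_def)
  then show "pt (S p z) (sqrt (Im z - (cmod (S p z))\<^sup>2)) = z"
    by (simp add: pt_def complex_eq_iff) (simp add: S_def)
qed

lemma delta_unique:
  assumes "\<delta> > 0" "\<delta>' > 0" "S p (pt lam \<delta>) = lam" "S p (pt lam \<delta>') = lam"
  shows "\<delta> = \<delta>'"
proof -
  have "pt lam \<delta> = pt lam \<delta>'"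
    using inj_onD[OF inj_on_S[of p]] assms pt_in_\<Omega> by metis
  then show ?thesis
    using assms(1,2) by (simp add: pt_def)
qed

text \<open>Together with \<open>H_entry_eq_0_iff\<close>, this says that the image consists of the
  points at which the (1,1) entry has a positive zero.\<close>

lemma mem_S_image_iff: "lam \<in> S p ` U p \<longleftrightarrow> (\<exists>\<delta>>0. S p (pt lam \<delta>) = lam)"
proof
  assume "lam \<in> S p ` U p"
  then show "\<exists>\<delta>>0. S p (pt lam \<delta>) = lam"
    by (metis (no_types, lifting) imageE pt_S)
next
  assume "\<exists>\<delta>>0. S p (pt lam \<delta>) = lam"
  then obtain \<delta> where d: "\<delta> > 0" "S p (pt lam \<delta>) = lam" by blast
  then have "pt lam \<delta> \<in> U p"
    using pt_in_\<Omega>[OF d(1)] by (simp add: U_def) (simp add: pt_def)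
  then show "lam \<in> S p ` U p"
    using d(2) by (metis imageI)
qed

lemma delta0_eq:
  assumes "\<delta> > 0" "S p (pt lam \<delta>) = lam"
  shows "delta0 \<phi> x p lam = \<delta>"
  unfolding delta0_def
proof (rule the_equality)
  show "0 < \<delta> \<and> H_entry \<phi> x p 1 1 lam (\<i> * complex_of_real \<delta>) = 0"
    using assms H_entry_eq_0_iff by blast
  fix \<delta>' assume "0 < \<delta>' \<and> H_entry \<phi> x p 1 1 lam (\<i> * complex_of_real \<delta>') = 0"
  then show "\<delta>' = \<delta>"
    using assms H_entry_eq_0_iff delta_unique by blast
qed

text \<open>At the zero, \<open>K z - 2 * Im (S p z)\<close> equals \<open>p\<close>. So
  \<open>p\<close> cancels in the (1,2) entry, and then \<open>S p z\<close> does too.\<close>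

lemma h_fun_S:
  assumes "p > 0" "z \<in> U p"
  shows "h_fun \<phi> x p (S p z) = \<Phi> z"
proof -
  obtain \<delta> where d: "\<delta> > 0" "pt (S p z) \<delta> = z"
    using pt_S[OF assms(2)] .
  have z: "z \<in> \<Omega>" using assms(2) by (simp add: U_def)
  have "delta0 \<phi> x p (S p z) = \<delta>"
    using d by (intro delta0_eq) auto
  then have "h_fun \<phi> x p (S p z) = S p z + of_real p * (\<i> - S p z * of_real (g z) + of_real (q z))
      / of_real (g z * (K z - 2 * Im (S p z)))"
    unfolding h_fun_def using H_entry_eq(3)[OF d(1), of p "S p z"] d(2) by simp
  also have "K z - 2 * Im (S p z) = p"
    by (simp add: S_def field_simps)
  also have "S p z + of_real p * (\<i> - S p z * of_real (g z) + of_real (q z)) / of_real (g z * p)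
      = (of_real (q z) + \<i>) / of_real (g z)"
    using g_pos[OF z] assms(1) by (simp add: field_simps)
  also have "\<dots> = \<Phi> z"
    by (simp add: \<Phi>_def complex_eq_iff)
  finally show ?thesis .
qed

text \<open>As \<open>f\<close> below is strictly increasing, a negative limit at 0 means that
  \<open>f\<close> takes a negative value, and since \<open>K\<close> is unbounded this is the same
  as having a positive zero.\<close>

lemma D_set_eq:
  assumes "p > 0"
  shows "D_set \<phi> x p = S p ` U p"
proof (rule set_eqI)
  fix lam
  define f where "f \<delta> = 1 - p / (K (pt lam \<delta>) - 2 * Im lam)" for \<delta>
  have f: "Im (H_entry \<phi> x p 1 1 lam (\<i> * of_real \<delta>)) / \<delta> = f \<delta>" if "\<delta> > 0" for \<delta>
    using that by (simp add: H_entry_eq(2) f_def)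
  have f_mono: "f \<delta> < f \<delta>'" if "0 < \<delta>" "\<delta> < \<delta>'" for \<delta> \<delta>'
    unfolding f_def using assms that H_entry_eq(1)[of \<delta> lam] K_pt_strict_mono[OF that, of lam]
    by (simp add: divide_strict_left_mono)
  have tendsto_cong: "((\<lambda>\<delta>. ereal (Im (H_entry \<phi> x p 1 1 lam (\<i> * of_real \<delta>)) / \<delta>)) \<longlongrightarrow> L) (at_right 0)
      \<longleftrightarrow> ((\<lambda>\<delta>. ereal (f \<delta>)) \<longlongrightarrow> L) (at_right 0)" for L
    by (intro filterlim_cong refl eventually_at_rightI[of 0 1]) (simp_all add: f)
  have "lam \<in> D_set \<phi> x p" if "lam \<in> S p ` U p"
  proof -
    from that obtain \<delta>\<^sub>0 where d: "\<delta>\<^sub>0 > 0" "S p (pt lam \<delta>\<^sub>0) = lam"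
      using mem_S_image_iff by blast
    have "f \<delta>\<^sub>0 = 0"
      using f[OF d(1)] H_entry_eq_0_iff[OF d(1), of p lam] d(2) by simp
    \<comment> \<open>The value at half the zero is strictly negative, which keeps the infimum away
      from 0.\<close>
    then have neg: "f (\<delta>\<^sub>0 / 2) < 0"
      using f_mono[of "\<delta>\<^sub>0 / 2" \<delta>\<^sub>0] d(1) by simp
    \<comment> \<open>By monotonicity the right limit at 0 is the infimum; in the extended reals it
      exists without a lower bound on \<open>f\<close>.\<close>
    define L where "L = (INF \<delta>\<in>{0<..}. ereal (f \<delta>))"
    have le: "L \<le> ereal (f \<delta>)" if "\<delta> > 0" for \<delta>
      unfolding L_def using that by (intro INF_lower) simp
    have "((\<lambda>\<delta>. ereal (f \<delta>)) \<longlongrightarrow> L) (at_right 0)"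
    proof (rule order_tendstoI)
      fix a assume "a < L"
      then show "\<forall>\<^sub>F \<delta> in at_right 0. a < ereal (f \<delta>)"
        by (intro eventually_at_rightI[of 0 1]) (use le in \<open>auto intro: less_le_trans\<close>)
    next
      fix a assume "L < a"
      then obtain \<delta> where \<delta>: "\<delta> > 0" "ereal (f \<delta>) < a"
        unfolding L_def INF_less_iff by auto
      show "\<forall>\<^sub>F \<delta> in at_right 0. ereal (f \<delta>) < a"
      proof (rule eventually_at_rightI[of 0 \<delta>])
        fix \<epsilon> assume "\<epsilon> \<in> {0<..<\<delta>}"
        then show "ereal (f \<epsilon>) < a"
          using f_mono[of \<epsilon> \<delta>] \<delta>(2) by (metis ereal_less(3) ereal_less_eq(3) greaterThanLessThan_iff less_eq_real_def order_le_less_trans)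
      qed (use \<delta> in simp)
    qed
    moreover have "L < 0"
      using le[of "\<delta>\<^sub>0 / 2"] neg d(1) by (simp add: order_le_less_trans)
    ultimately show ?thesis
      unfolding D_set_def using tendsto_cong by blast
  qed
  moreover have "lam \<in> S p ` U p" if "lam \<in> D_set \<phi> x p"
  proof -
    from that obtain L where L: "((\<lambda>\<delta>. ereal (f \<delta>)) \<longlongrightarrow> L) (at_right 0)" "L < 0"
      unfolding D_set_def by (auto simp: tendsto_cong)
    have "\<forall>\<^sub>F \<delta> in at_right 0. 0 < \<delta> \<and> ereal (f \<delta>) < 0"
      using order_tendstoD(2)[OF L] eventually_at_right_less by (rule eventually_conj[rotated])
    then obtain \<delta>\<^sub>1 where d1: "\<delta>\<^sub>1 > 0" "f \<delta>\<^sub>1 < 0"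
      using eventually_happens[of _ "at_right (0::real)"] by auto
    then have lo: "K (pt lam \<delta>\<^sub>1) \<le> p + 2 * Im lam"
      using H_entry_eq(1)[OF d1(1), of lam] by (simp add: f_def field_simps)
    obtain c0 where c0: "\<And>c. c \<ge> c0 \<Longrightarrow> K (Complex (Re lam) c) \<ge> p + 2 * Im lam"
      using K_unbounded by blast
    \<comment> \<open>The maximum keeps \<open>\<delta>\<^sub>2\<close> to the right of
      \<open>\<delta>\<^sub>1\<close>, and its square reaches \<open>c0\<close>.\<close>
    define \<delta>\<^sub>2 where "\<delta>\<^sub>2 = max \<delta>\<^sub>1 (sqrt \<bar>c0\<bar>)"
    have "\<bar>c0\<bar> \<le> \<delta>\<^sub>2\<^sup>2"
      by (rule sqrt_le_D) (simp add: \<delta>\<^sub>2_def)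
    then have hi: "p + 2 * Im lam \<le> K (pt lam \<delta>\<^sub>2)"
      unfolding pt_def by (intro c0) (smt (verit) zero_le_power2)
    have "continuous_on {\<delta>\<^sub>1..\<delta>\<^sub>2} (\<lambda>\<delta>. K (pt lam \<delta>))"
    proof (rule continuous_on_compose2[of \<Omega> K])
      show "continuous_on \<Omega> K"
        using K_has_derivative by (meson continuous_at_imp_continuous_on has_derivative_continuous)
      show "continuous_on {\<delta>\<^sub>1..\<delta>\<^sub>2} (pt lam)"
        unfolding pt_def Complex_eq by (intro continuous_intros)
      show "pt lam ` {\<delta>\<^sub>1..\<delta>\<^sub>2} \<subseteq> \<Omega>"
        using pt_in_\<Omega> d1(1) by auto
    qed
    then obtain \<delta> where "\<delta>\<^sub>1 \<le> \<delta>" "K (pt lam \<delta>) = p + 2 * Im lam"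
      using IVT'[of "\<lambda>\<delta>. K (pt lam \<delta>)", OF lo hi] by (auto simp: \<delta>\<^sub>2_def)
    then have "\<delta> > 0" "S p (pt lam \<delta>) = lam"
      using d1(1) by (simp_all add: S_def complex_eq_iff) (simp add: pt_def)
    then show ?thesis
      using mem_S_image_iff by blast
  qed
  ultimately show "lam \<in> D_set \<phi> x p \<longleftrightarrow> lam \<in> S p ` U p"
    by blast
qed

section \<open>Smoothness of \<open>h_fun\<close> and of its inverse\<close>

lemma S_has_derivative:
  assumes "z \<in> \<Omega>"
  shows "(S p has_derivative (\<lambda>v. Complex (Re v) (K' z v / 2))) (at z)"
proof -
  have "((\<lambda>z. Complex (Re z) ((K z - p) / 2)) has_derivative (\<lambda>v. Complex (Re v) (K' z v / 2))) (at z)"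
    by (auto intro!: derivative_eq_intros has_derivative_Complex K_has_derivative assms)
  then show ?thesis by (simp add: S_def[abs_def])
qed

text \<open>The real part forces \<open>v\<close> to be vertical, and in that direction
  \<open>K'\<close> vanishes only at 0.\<close>

lemma S_derivative_kernel:
  assumes "z \<in> \<Omega>" "Complex (Re v) (K' z v / 2) = 0"
  shows "v = 0"
proof -
  have "Re v = 0" "K' z v = 0" using assms(2) by (auto simp: complex_eq_iff)
  then show ?thesis
    using K'_vertical[OF assms(1), of v] K'_vertical_pos[OF assms(1)]
    by (simp add: complex_eq_iff)
qed

lemma open_U: "open (U p)"
proof -
  have "continuous_on \<Omega> (S p)"
    using S_has_derivative by (meson continuous_at_imp_continuous_on has_derivative_continuous)
  then have "continuous_on \<Omega> (\<lambda>z. Im z - (cmod (S p z))\<^sup>2)"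
    by (intro continuous_intros)
  then have "open (\<Omega> \<inter> (\<lambda>z. Im z - (cmod (S p z))\<^sup>2) -` {0<..})"
    by (intro continuous_open_preimage open_Omega) auto
  also have "\<Omega> \<inter> (\<lambda>z. Im z - (cmod (S p z))\<^sup>2) -` {0<..} = U p"
    by (auto simp: U_def)
  finally show ?thesis .
qed

lemma U_subset: "U p \<subseteq> \<Omega>"
  by (auto simp: U_def)

lemma delta0_S:
  assumes "z \<in> U p"
  shows "delta0 \<phi> x p (S p z) = sqrt (Im z - (cmod (S p z))\<^sup>2)"
proof -
  obtain \<delta> where d: "\<delta> > 0" "pt (S p z) \<delta> = z"
    using pt_S[OF assms] .
  then have "delta0 \<phi> x p (S p z) = \<delta>"
    by (intro delta0_eq) auto
  moreover have "Im z = \<delta>\<^sup>2 + (cmod (S p z))\<^sup>2"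
    using arg_cong[OF d(2), of Im] by (simp add: pt_def)
  ultimately show ?thesis
    using d(1) by (simp add: real_sqrt_abs)
qed

lemma h_fun_diffeomorphism:
  assumes "p > 0"
  shows "open (D_set \<phi> x p)" and "open (M_set \<phi> x p)"
    and "delta0 \<phi> x p differentiable_on D_set \<phi> x p"
    and "h_fun \<phi> x p differentiable_on D_set \<phi> x p"
    and "inj_on (h_fun \<phi> x p) (D_set \<phi> x p)"
    and "inv_into (D_set \<phi> x p) (h_fun \<phi> x p) differentiable_on M_set \<phi> x p"
proof -
  let ?D = "D_set \<phi> x p" and ?M = "M_set \<phi> x p" and ?h = "h_fun \<phi> x p"
  \<comment> \<open>\<open>T\<close> recovers the pair \<open>(a, c)\<close> from
    \<open>lam\<close>, so \<open>h_fun\<close> is \<Phi> after \<open>T\<close> on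
    \<open>D_set\<close>.\<close>
  define T where "T = inv_into (U p) (S p)"
  note D = D_set_eq[OF assms]
  have injS: "inj_on (S p) (U p)" and inj\<Phi>: "inj_on \<Phi> (U p)"
    using inj_on_S inj_on_\<Phi> U_subset inj_on_subset by blast+
  have TS: "T (S p z) = z" if "z \<in> U p" for z
    using that injS by (simp add: T_def)
  have T_in: "T lam \<in> U p" and ST: "S p (T lam) = lam" if "lam \<in> ?D" for lam
    using that TS by (auto simp: D)
  have S_image: "open (S p ` U p)" "T differentiable_on S p ` U p"
    unfolding T_def using U_subset
    by (intro inverse_differentiable_on_image[OF open_U injS S_has_derivative S_derivative_kernel]; blast)+
  have \<Phi>_image: "open (\<Phi> ` U p)" "inv_into (U p) \<Phi> differentiable_on \<Phi> ` U p"
    using U_subset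
    by (intro inverse_differentiable_on_image[OF open_U inj\<Phi> \<Phi>_has_derivative \<Phi>_derivative_kernel]; blast)+
  have T_diff: "T differentiable (at lam)" if "lam \<in> ?D" for lam
    using S_image(2) that by (simp only: D differentiable_on_eq_differentiable_at[OF S_image(1)])
  have h: "?h lam = \<Phi> (T lam)" if "lam \<in> ?D" for lam
    using h_fun_S[OF assms T_in[OF that]] ST[OF that] by simp
  have M: "?M = \<Phi> ` U p"
    unfolding M_set_def D image_image using h_fun_S[OF assms] by (intro image_cong) auto
  show "open ?D" "open ?M"
    using S_image(1) \<Phi>_image(1) by (simp_all add: D M)
  have sqrt_diff: "(\<lambda>lam. sqrt (Im (T lam) - (cmod lam)\<^sup>2)) differentiable_on ?D"
    unfolding differentiable_on_def
  proof
    fix lam assume lam: "lam \<in> ?D"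
    obtain T' where T': "(T has_derivative T') (at lam)"
      using T_diff[OF lam] by (auto simp: differentiable_def)
    \<comment> \<open>Membership in \<open>U p\<close> keeps the radicand positive, where the square
      root is differentiable. The modulus is expanded into squares of coordinates, which are
      differentiable also at 0.\<close>
    have "Im (T lam) - ((Re lam)\<^sup>2 + (Im lam)\<^sup>2) > 0"
      using T_in[OF lam] ST[OF lam] by (simp add: U_def cmod_power2)
    moreover have "((\<lambda>lam. Im (T lam) - ((Re lam)\<^sup>2 + (Im lam)\<^sup>2)) has_derivative
        (\<lambda>v. Im (T' v) - (2 * Re lam * Re v + 2 * Im lam * Im v))) (at lam)"
      by (auto intro!: derivative_eq_intros T')
    ultimately have "(\<lambda>lam. sqrt (Im (T lam) - ((Re lam)\<^sup>2 + (Im lam)\<^sup>2))) differentiable (at lam)"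
      by (intro differentiableI[OF has_derivative_real_sqrt[
            where g = "\<lambda>lam. Im (T lam) - ((Re lam)\<^sup>2 + (Im lam)\<^sup>2)"]])
    then show "(\<lambda>lam. sqrt (Im (T lam) - (cmod lam)\<^sup>2)) differentiable (at lam within ?D)"
      unfolding cmod_power2 by (rule differentiable_at_withinI)
  qed
  show "delta0 \<phi> x p differentiable_on ?D"
    using T_in ST delta0_S by (intro differentiable_on_transform[OF sqrt_diff]) metis
  have "(\<lambda>lam. \<Phi> (T lam)) differentiable_on ?D"
    unfolding differentiable_on_def
  proof
    fix lam assume lam: "lam \<in> ?D"
    then have "T lam \<in> \<Omega>" using T_in U_subset by blast
    then have "\<Phi> differentiable at (T lam)"
      by (rule differentiableI[OF \<Phi>_has_derivative])
    then show "(\<lambda>lam. \<Phi> (T lam)) differentiable (at lam within ?D)"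
      using differentiable_at_withinI[OF differentiable_chain_at[OF T_diff[OF lam]]]
      by (simp add: comp_def)
  qed
  then show "?h differentiable_on ?D"
    using h by (rule differentiable_on_transform)
  show inj_h: "inj_on ?h ?D"
    using inj\<Phi> h T_in ST by (metis (no_types, lifting) inj_on_def)
  \<comment> \<open>The inverse of \<open>h_fun\<close> is \<open>S p\<close> after the inverse of
    \<Phi>, both differentiable.\<close>
  have inv: "inv_into ?D ?h m = S p (inv_into (U p) \<Phi> m)" if "m \<in> ?M" for m
  proof -
    have "m \<in> \<Phi> ` U p" using that by (simp only: M)
    then obtain z where z: "z \<in> U p" "m = \<Phi> z" by blast
    then have "m = ?h (S p z)" "S p z \<in> ?D"
      using h_fun_S[OF assms z(1)] by (auto simp: D)
    then show ?thesis
      using inv_into_f_f[OF inj_h] inv_into_f_f[OF inj\<Phi> z(1)] z(2) by metis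
  qed
  have "(\<lambda>m. S p (inv_into (U p) \<Phi> m)) differentiable_on ?M"
    unfolding differentiable_on_def
  proof
    fix m assume m: "m \<in> ?M"
    then have "inv_into (U p) \<Phi> m \<in> \<Omega>"
      using U_subset inv_into_into[of m \<Phi> "U p"] by (auto simp only: M)
    then have "S p differentiable at (inv_into (U p) \<Phi> m)"
      by (rule differentiableI[OF S_has_derivative])
    moreover have "inv_into (U p) \<Phi> differentiable (at m)"
      using \<Phi>_image(2) m by (simp only: M differentiable_on_eq_differentiable_at[OF \<Phi>_image(1)])
    ultimately show "(\<lambda>m. S p (inv_into (U p) \<Phi> m)) differentiable (at m within ?M)"
      using differentiable_at_withinI[OF differentiable_chain_at[of "inv_into (U p) \<Phi>" m "S p"]]
      by (simp add: comp_def)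
  qed
  then show "inv_into ?D ?h differentiable_on ?M"
    using inv by (rule differentiable_on_transform)
qed

end

theorem proposition1p7:
  fixes \<phi> :: "'a::cstar_algebra \<Rightarrow> complex"
    and x y :: 'a and p :: real and \<mu> :: "real measure"
  assumes "wstar_probability_space \<phi>" and "faithful \<phi>" and "tracial \<phi>"
    and "selfadjoint x" and "selfadjoint y"
    and "freely_independent \<phi> x y"
    and "p > 0" and "free_poisson \<phi> y p"
    and "has_distribution \<phi> x \<mu>"
    and "\<not> (\<exists>c. \<mu> = return borel c)"
  shows "open (D_set \<phi> x p) \<and> open (M_set \<phi> x p) \<and>
     delta0 \<phi> x p differentiable_on D_set \<phi> x p \<and>
     h_fun \<phi> x p differentiable_on D_set \<phi> x p \<and>
     inj_on (h_fun \<phi> x p) (D_set \<phi> x p) \<and>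
     bij_betw (h_fun \<phi> x p) (D_set \<phi> x p) (M_set \<phi> x p) \<and>
     inv_into (D_set \<phi> x p) (h_fun \<phi> x p) differentiable_on M_set \<phi> x p"
proof -
  have state: "state \<phi>"
    using assms(1) by (simp add: wstar_probability_space_def)
  interpret selfadjoint_nonscalar \<phi> x
  proof (rule selfadjoint_nonscalar.intro)
    show "x \<noteq> r *\<^sub>R 1" for r
      using distribution_of_scalar[OF state] assms(9,10) by blast
  qed (use state assms(2,4) wstar_bounded_linear[OF assms(1)] in auto)
  show ?thesis
    using h_fun_diffeomorphism[OF \<open>p > 0\<close>] by (auto simp: bij_betw_def M_set_def)
qed

end
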